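(* Let $0<\gamma<1$ and let $G=\mathbb Z$ with weighted adjacency matrix $A(n,n\pm1)=1$ for $n\neq 0$, $A(0,\pm1)=\gamma$, and $A(x,y)=0$ otherwise. Put $\Lambda=\frac{2(1-\gamma)}{\gamma}$ and, for $n\in\mathbb Z$, $$\psi^{(+)}(n)=\begin{cases}1+\Lambda |n| & n\ge 0\\ 1& n\le 0\end{cases},\qquad \psi^{(-)}(n)=\begin{cases}1+\Lambda |n| & n\le 0\\ 1& n\ge 0\end{cases}.$$ For integers $p,q\ge 1$ let $H_{p,q}=\{-q+1,\dots,p-1\}\subset \mathbb Z$, let $\rho(H_{p,q})$ be the spectral radius of the restriction of $A$ to $H_{p,q}\times H_{p,q}$, and let $\psi_{p,q}:H_{p,q}\to(0,\infty)$ be the unique eigenfunction of this restriction associated with $\rho(H_{p,q})$ and satisfying $\psi_{p,q}(0)=1$. Then the set of all (pointwise) limit points of $\psi_{p,q}$ as $p,q\to\infty$ is exactly the set of functions $$\mu_\delta\,\psi^{(+)}+(1-\mu_\delta)\,\psi^{(-)},\qquad \delta\in\mathbb Z\sqcup\{\pm\infty\},$$ where $$\mu_\delta=\frac{\sqrt{\Lambda^2\delta^2+4}+\Lambda\delta-2}{2\delta\Lambda}\in[0,1],$$ this expression being extended by continuity at $\delta\in\{0,+\infty,-\infty\}$. In particular, the set of all MERWs on $G$ that can be obtained as limits of the MERWs on the finite subgraphs $H_{p,q}$, as $p,q\to\infty$, is the discrete (quantized) family of MERWs associated with these functions.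
   Context: A limit point of $\psi_{p,q}$ as $p,q\to\infty$ is a function $\psi:\mathbb Z\to\mathbb R$ such that for some sequence $(p_j,q_j)$ with $p_j\to\infty$ and $q_j\to\infty$ one has $\psi_{p_j,q_j}(n)\to\psi(n)$ for every $n\in\mathbb Z$. For a countable irreducible weighted graph with weighted adjacency matrix $A\ge 0$, the combinatorial spectral radius $\rho$ is the inverse of the radius of convergence of $\sum_{n\ge0}A^n(x,y)z^n$ (independent of $x,y$; for a finite graph it is the Perron–Frobenius eigenvalue). A MERW (maximal entropy random walk) is a Markov chain with kernel $P(x,y)=A(x,y)\frac{\psi(y)}{\rho\,\psi(x)}$ where $\psi>0$ satisfies $A\psi=\rho\psi$; it is said to be associated with $\psi$. On a finite irreducible weighted graph there is exactly one MERW. For the graph $G=\mathbb Z$ of the statement, $\rho=2$. Limits of MERWs are understood as pointwise limits of their Markov kernels. *)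

theory Defs
  imports "HOL-Analysis.Analysis" "HOL-Library.Extended" "HOL-Real_Asymp.Real_Asymp"
begin

text \<open>
  A weighted graph is given by its vertex set \<open>V\<close> and its weighted adjacency matrix
  \<open>A :: 'a \<Rightarrow> 'a \<Rightarrow> real\<close>, of which only the entries indexed by \<open>V \<times> V\<close> matter; replacing
  \<open>V\<close> by a subset therefore restricts the matrix. The matrices are meant to be
  nonnegative with finitely many nonzero entries in each row, so that the unordered sums below are
  finite sums.
\<close>

primrec matrix_power :: "'a set \<Rightarrow> ('a \<Rightarrow> 'a \<Rightarrow> real) \<Rightarrow> nat \<Rightarrow> 'a \<Rightarrow> 'a \<Rightarrow> real" where
  "matrix_power V A 0 x y = (if x = y then 1 else 0)"
| "matrix_power V A (Suc n) x y = (\<Sum>\<^sub>\<infinity>z\<in>V. A x z * matrix_power V A n z y)"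

text \<open>
  The combinatorial spectral radius: the common value, over all \<open>x, y \<in> V\<close>, of the inverse of the
  radius of convergence of the series with coefficients \<open>A\<^sup>n(x,y)\<close>. It is \<open>0\<close> for the single
  vertex without loop, where the radius of convergence is infinite.
\<close>

definition comb_spectral_radius :: "'a set \<Rightarrow> ('a \<Rightarrow> 'a \<Rightarrow> real) \<Rightarrow> real" where
  "comb_spectral_radius V A =
     (THE r. \<forall>x\<in>V. \<forall>y\<in>V. inverse (conv_radius (\<lambda>n. matrix_power V A n x y)) = ereal r)"

definition rho_eigenfunction :: "'a set \<Rightarrow> ('a \<Rightarrow> 'a \<Rightarrow> real) \<Rightarrow> ('a \<Rightarrow> real) \<Rightarrow> bool" where
  "rho_eigenfunction V A \<psi> \<longleftrightarrow>
     (\<forall>x\<in>V. ((\<lambda>y. A x y * \<psi> y) has_sum (comb_spectral_radius V A * \<psi> x)) V)"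

definition merw_kernel ::
    "'a set \<Rightarrow> ('a \<Rightarrow> 'a \<Rightarrow> real) \<Rightarrow> ('a \<Rightarrow> real) \<Rightarrow> 'a \<Rightarrow> 'a \<Rightarrow> real" where
  "merw_kernel V A \<psi> x y = A x y * (\<psi> y / (comb_spectral_radius V A * \<psi> x))"

definition markov_kernel_on :: "'a set \<Rightarrow> ('a \<Rightarrow> 'a \<Rightarrow> real) \<Rightarrow> bool" where
  "markov_kernel_on V P \<longleftrightarrow>
     (\<forall>x\<in>V. (\<forall>y\<in>V. 0 \<le> P x y) \<and> ((\<lambda>y. P x y) has_sum 1) V)"

text \<open>The values of \<open>P\<close> outside \<open>V \<times> V\<close> are irrelevant.\<close>

definition is_merw :: "'a set \<Rightarrow> ('a \<Rightarrow> 'a \<Rightarrow> real) \<Rightarrow> ('a \<Rightarrow> 'a \<Rightarrow> real) \<Rightarrow> bool" where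
  "is_merw V A P \<longleftrightarrow> markov_kernel_on V P \<and>
     (\<exists>\<psi>. (\<forall>x\<in>V. 0 < \<psi> x) \<and> rho_eigenfunction V A \<psi> \<and>
          (\<forall>x\<in>V. \<forall>y\<in>V. P x y = merw_kernel V A \<psi> x y))"

definition adjacency :: "real \<Rightarrow> int \<Rightarrow> int \<Rightarrow> real" where
  "adjacency \<gamma> x y =
     (if y = x + 1 \<or> y = x - 1 then (if x = 0 then \<gamma> else 1) else 0)"

definition H :: "int \<Rightarrow> int \<Rightarrow> int set" where
  "H p q = {- q + 1 .. p - 1}"

text \<open>
  A function on \<open>H p q\<close> is represented by its extension by \<open>0\<close> to the integers, which makes
  uniqueness meaningful.
\<close>

definition is_psi_pq :: "real \<Rightarrow> int \<Rightarrow> int \<Rightarrow> (int \<Rightarrow> real) \<Rightarrow> bool" where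
  "is_psi_pq \<gamma> p q \<psi> \<longleftrightarrow>
     rho_eigenfunction (H p q) (adjacency \<gamma>) \<psi> \<and> \<psi> 0 = 1 \<and> (\<forall>n. n \<notin> H p q \<longrightarrow> \<psi> n = 0)"

definition psi_pq :: "real \<Rightarrow> int \<Rightarrow> int \<Rightarrow> int \<Rightarrow> real" where
  "psi_pq \<gamma> p q = (THE \<psi>. is_psi_pq \<gamma> p q \<psi>)"

definition limit_points_pq :: "(int \<Rightarrow> int \<Rightarrow> int \<Rightarrow> real) \<Rightarrow> (int \<Rightarrow> real) set" where
  "limit_points_pq F = {\<psi>. \<exists>p q :: nat \<Rightarrow> int.
     (\<forall>j. 1 \<le> p j \<and> 1 \<le> q j) \<and>
     filterlim p at_top sequentially \<and> filterlim q at_top sequentially \<and>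
     (\<forall>n. (\<lambda>j. F (p j) (q j) n) \<longlonglongrightarrow> \<psi> n)}"

definition merw_limits :: "(int \<Rightarrow> int \<Rightarrow> real) \<Rightarrow> (int \<Rightarrow> int \<Rightarrow> real) set" where
  "merw_limits A = {P. is_merw UNIV A P \<and>
     (\<exists>(p :: nat \<Rightarrow> int) (q :: nat \<Rightarrow> int) (Q :: nat \<Rightarrow> int \<Rightarrow> int \<Rightarrow> real).
        (\<forall>j. 1 \<le> p j \<and> 1 \<le> q j) \<and>
        filterlim p at_top sequentially \<and> filterlim q at_top sequentially \<and>
        (\<forall>j. is_merw (H (p j) (q j)) A (Q j)) \<and>
        (\<forall>x y. (\<lambda>j. Q j x y) \<longlonglongrightarrow> P x y))}"

definition Lam :: "real \<Rightarrow> real" where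
  "Lam \<gamma> = 2 * (1 - \<gamma>) / \<gamma>"

definition psi_plus :: "real \<Rightarrow> int \<Rightarrow> real" where
  "psi_plus \<gamma> n = (if 0 \<le> n then 1 + Lam \<gamma> * \<bar>real_of_int n\<bar> else 1)"

definition psi_minus :: "real \<Rightarrow> int \<Rightarrow> real" where
  "psi_minus \<gamma> n = (if n \<le> 0 then 1 + Lam \<gamma> * \<bar>real_of_int n\<bar> else 1)"

definition mu_expr :: "real \<Rightarrow> real \<Rightarrow> real" where
  "mu_expr \<gamma> \<delta> =
     (sqrt ((Lam \<gamma>)\<^sup>2 * \<delta>\<^sup>2 + 4) + Lam \<gamma> * \<delta> - 2) / (2 * \<delta> * Lam \<gamma>)"

text \<open>
  The index set of integers together with \<open>\<plusminus>\<infinity>\<close> is \<^typ>\<open>int extended\<close>; at \<open>0\<close> and \<open>\<plusminus>\<infinity>\<close> the expression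
  is extended by continuity, as a function of a real variable. The limits exist (see below).
\<close>

definition mu :: "real \<Rightarrow> int extended \<Rightarrow> real" where
  "mu \<gamma> \<delta> = (case \<delta> of
       Fin d \<Rightarrow> (if d = 0 then Lim (at 0) (mu_expr \<gamma>) else mu_expr \<gamma> (real_of_int d))
     | Pinf \<Rightarrow> Lim at_top (mu_expr \<gamma>)
     | Minf \<Rightarrow> Lim at_bot (mu_expr \<gamma>))"

definition psi_delta :: "real \<Rightarrow> int extended \<Rightarrow> int \<Rightarrow> real" where
  "psi_delta \<gamma> \<delta> n = mu \<gamma> \<delta> * psi_plus \<gamma> n + (1 - mu \<gamma> \<delta>) * psi_minus \<gamma> n"

lemma Lam_pos: "0 < \<gamma> \<Longrightarrow> \<gamma> < 1 \<Longrightarrow> 0 < Lam \<gamma>"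
  by (simp add: Lam_def)

lemma mu_expr_tendsto:
  assumes "0 < \<gamma>" "\<gamma> < 1"
  shows "(mu_expr \<gamma> \<longlongrightarrow> 1 / 2) (at 0)"
    and "(mu_expr \<gamma> \<longlongrightarrow> 1) at_top"
    and "(mu_expr \<gamma> \<longlongrightarrow> 0) at_bot"
proof -
  define L where "L = Lam \<gamma>"
  have L: "0 < L"
    using Lam_pos assms by (simp add: L_def)
  have e: "mu_expr \<gamma> = (\<lambda>x. (sqrt (L\<^sup>2 * x\<^sup>2 + 4) + L * x - 2) / (2 * x * L))"
    by (simp add: mu_expr_def L_def fun_eq_iff)
  show "(mu_expr \<gamma> \<longlongrightarrow> 1 / 2) (at 0)"
    unfolding e using L by real_asymp
  show "(mu_expr \<gamma> \<longlongrightarrow> 1) at_top"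
    unfolding e using L by real_asymp
  show "(mu_expr \<gamma> \<longlongrightarrow> 0) at_bot"
    unfolding e using L by real_asymp
qed

lemma mu_endpoints:
  assumes "0 < \<gamma>" "\<gamma> < 1"
  shows "mu \<gamma> (Fin 0) = 1 / 2" and "mu \<gamma> Pinf = 1" and "mu \<gamma> Minf = 0"
  using mu_expr_tendsto[OF assms]
  by (simp_all add: mu_def tendsto_Lim)

end

theory Submission
  imports Defs
begin

text \<open>
  The positive eigenfunction on \<open>H p q\<close> with eigenvalue \<open>2 cos \<theta>\<close> is \<open>sin ((p - \<bar>n\<bar>) \<theta>) / sin (p \<theta>)\<close> to
  the right of \<open>0\<close> and the same with \<open>q\<close> in place of \<open>p\<close> to the left, where the equation at \<open>0\<close> reads
  \<open>cot (p \<theta>) + cot (q \<theta>) + \<Lambda> cot \<theta> = 0\<close>. A positive eigenvector determines the spectral radius: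
  it bounds the walk weights from above, and paired with the corresponding left eigenvector it shows that the
  generating series diverges at the inverse eigenvalue. Put \<open>y = - tan \<theta> cot (q \<theta>) / \<Lambda>\<close>, so that
  \<open>1 - y = - tan \<theta> cot (p \<theta>) / \<Lambda>\<close>; as \<open>\<theta> \<rightarrow> 0\<close> the eigenfunction approaches
  \<open>(1 - y) \<psi>\<^sup>+ + y \<psi>\<^sup>-\<close>. The subtraction formula for the cotangent gives
  \<open>\<Lambda> y (1 - y) + tan\<^sup>2 \<theta> / \<Lambda> = (1 - 2 y) tan \<theta> cot ((p - q) \<theta>)\<close>. The last factor tends to
  \<open>1 / (p - q)\<close> when the integer \<open>p - q\<close> is eventually constant and to \<open>0\<close> when \<open>p - q \<rightarrow> \<infinity>\<close>, which
  produces the quantized weights. Every sequence \<open>(p, q)\<close> has a subsequence of one of these kinds.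
\<close>

section \<open>The spectral radius from a positive eigenvector\<close>

text \<open>With \<open>nbr_sum\<close> this factors the adjacency matrix into a diagonal matrix
  times the symmetric nearest-neighbour matrix of the path. The diagonal factor carries all the
  asymmetry.\<close>

definition vertex_weight :: "real \<Rightarrow> int \<Rightarrow> real" where
  "vertex_weight \<gamma> x = (if x = 0 then \<gamma> else 1)"

definition nbr_sum :: "int set \<Rightarrow> (int \<Rightarrow> real) \<Rightarrow> int \<Rightarrow> real" where
  "nbr_sum V f x = (\<Sum>z\<in>V \<inter> {x - 1, x + 1}. f z)"

lemma vertex_weight_pos: "0 < \<gamma> \<Longrightarrow> 0 < vertex_weight \<gamma> x"
  by (simp add: vertex_weight_def)

lemma nbr_sum_cong: "(\<And>z. z \<in> V \<Longrightarrow> f z = g z) \<Longrightarrow> nbr_sum V f x = nbr_sum V g x"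
  by (auto simp: nbr_sum_def intro: sum.cong)

lemma nbr_sum_mono: "(\<And>z. z \<in> V \<Longrightarrow> f z \<le> g z) \<Longrightarrow> nbr_sum V f x \<le> nbr_sum V g x"
  by (auto simp: nbr_sum_def intro: sum_mono)

lemma nbr_sum_nonneg: "(\<And>z. z \<in> V \<Longrightarrow> 0 \<le> f z) \<Longrightarrow> 0 \<le> nbr_sum V f x"
  by (auto simp: nbr_sum_def intro: sum_nonneg)

lemma nbr_sum_mult_right: "nbr_sum V f x * c = nbr_sum V (\<lambda>z. f z * c) x"
  by (simp add: nbr_sum_def sum_distrib_right)

lemma nbr_sum_UNIV: "nbr_sum UNIV f x = f (x - 1) + f (x + 1)"
  by (simp add: nbr_sum_def)

text \<open>Extension by zero turns the restricted operator into the full two-neighbour sum, with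
  zero boundary values.\<close>

lemma nbr_sum_supported:
  assumes "\<And>z. z \<notin> V \<Longrightarrow> f z = 0"
  shows "nbr_sum V f x = f (x - 1) + f (x + 1)"
proof -
  have "nbr_sum V f x = nbr_sum UNIV f x"
    unfolding nbr_sum_def by (rule sum.mono_neutral_left) (use assms in auto)
  then show ?thesis by (simp add: nbr_sum_UNIV)
qed

lemma adjacency_has_sum:
  "((\<lambda>y. adjacency \<gamma> x y * f y) has_sum (vertex_weight \<gamma> x * nbr_sum V f x)) V"
proof -
  have "((\<lambda>y. adjacency \<gamma> x y * f y) has_sum
      (\<Sum>y\<in>V \<inter> {x - 1, x + 1}. adjacency \<gamma> x y * f y)) (V \<inter> {x - 1, x + 1})"
    by simp
  also have "(\<Sum>y\<in>V \<inter> {x - 1, x + 1}. adjacency \<gamma> x y * f y) = vertex_weight \<gamma> x * nbr_sum V f x"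
    unfolding nbr_sum_def sum_distrib_left
    by (rule sum.cong) (auto simp: adjacency_def vertex_weight_def)
  finally show ?thesis
    by (rule has_sum_cong_neutral[THEN iffD1, rotated -1]) (auto simp: adjacency_def)
qed

lemma rho_eigenfunction_adjacency_iff:
  "rho_eigenfunction V (adjacency \<gamma>) \<psi> \<longleftrightarrow>
     (\<forall>x\<in>V. vertex_weight \<gamma> x * nbr_sum V \<psi> x = comb_spectral_radius V (adjacency \<gamma>) * \<psi> x)"
  unfolding rho_eigenfunction_def
  using adjacency_has_sum has_sum_unique by metis

section \<open>Growth of walk weights against a positive eigenvector\<close>

abbreviation walk_weight :: "real \<Rightarrow> int set \<Rightarrow> nat \<Rightarrow> int \<Rightarrow> int \<Rightarrow> real" where
  "walk_weight \<gamma> V \<equiv> matrix_power V (adjacency \<gamma>)"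

lemma walk_weight_Suc:
  "walk_weight \<gamma> V (Suc n) x y = vertex_weight \<gamma> x * nbr_sum V (\<lambda>z. walk_weight \<gamma> V n z y) x"
  by (simp add: infsumI[OF adjacency_has_sum])

declare matrix_power.simps(2) [simp del]

lemma walk_weight_nonneg: "0 < \<gamma> \<Longrightarrow> 0 \<le> walk_weight \<gamma> V n x y"
  by (induction n arbitrary: x)
     (auto simp: walk_weight_Suc intro!: mult_nonneg_nonneg nbr_sum_nonneg intro: less_imp_le[OF vertex_weight_pos])

lemma walk_weight_mono:
  assumes "0 < \<gamma>" "V \<subseteq> W"
  shows "walk_weight \<gamma> V n x y \<le> walk_weight \<gamma> W n x y"
proof (induction n arbitrary: x)
  case (Suc n)
  have "nbr_sum V (\<lambda>z. walk_weight \<gamma> V n z y) x \<le> nbr_sum V (\<lambda>z. walk_weight \<gamma> W n z y) x"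
    by (rule nbr_sum_mono) (rule Suc)
  also have "\<dots> \<le> nbr_sum W (\<lambda>z. walk_weight \<gamma> W n z y) x"
    unfolding nbr_sum_def using assms by (intro sum_mono2) (auto intro: walk_weight_nonneg)
  finally show ?case
    using vertex_weight_pos[OF assms(1), of x] by (simp add: walk_weight_Suc)
qed simp

text \<open>The left side is a single nonnegative summand of A^n h = \<rho>^n h. The induction
  carries the bound through the first step of the walk.\<close>

lemma walk_weight_le:
  assumes \<gamma>: "0 < \<gamma>" and h: "\<And>x. x \<in> V \<Longrightarrow> 0 < h x" and "0 \<le> \<rho>"
    and eig: "\<And>x. x \<in> V \<Longrightarrow> vertex_weight \<gamma> x * nbr_sum V h x = \<rho> * h x"
    and "x \<in> V" "y \<in> V"
  shows "walk_weight \<gamma> V n x y * h y \<le> \<rho> ^ n * h x"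
  using \<open>x \<in> V\<close>
proof (induction n arbitrary: x)
  case 0
  then show ?case using h[of x] by simp
next
  case (Suc n)
  have "walk_weight \<gamma> V (Suc n) x y * h y
      = vertex_weight \<gamma> x * nbr_sum V (\<lambda>z. walk_weight \<gamma> V n z y * h y) x"
    by (simp add: walk_weight_Suc nbr_sum_mult_right)
  also have "\<dots> \<le> vertex_weight \<gamma> x * nbr_sum V (\<lambda>z. h z * \<rho> ^ n) x"
    using Suc.IH vertex_weight_pos[OF \<gamma>, of x]
    by (intro mult_left_mono nbr_sum_mono) (auto simp: mult.commute)
  also have "\<dots> = (vertex_weight \<gamma> x * nbr_sum V h x) * \<rho> ^ n"
    by (simp add: nbr_sum_mult_right)
  also have "\<dots> = \<rho> ^ Suc n * h x"
    using eig Suc.prems by simp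
  finally show ?case .
qed

lemma inverse_conv_radius_le:
  fixes a :: "nat \<Rightarrow> real"
  assumes "\<And>n. \<bar>a n\<bar> \<le> C * \<rho> ^ n" "0 \<le> \<rho>"
  shows "inverse (conv_radius a) \<le> ereal \<rho>"
\<comment> \<open>For \<rho> = 0 every coefficient after the zeroth vanishes, so the radius is
  infinite with inverse 0; the one-vertex interval is of this kind. Otherwise a geometric series
  dominates.\<close>
proof (cases "\<rho> = 0")
  case True
  have "conv_radius a = conv_radius (\<lambda>_. 0 :: real)"
  proof (rule conv_radius_cong')
    show "\<forall>\<^sub>F n in sequentially. a n = 0"
      using assms True by (intro eventually_sequentiallyI[of 1]) (metis abs_le_zero_iff mult_zero_right not_one_le_zero zero_power2 power_0_left)
  qed
  then show ?thesis using True by simp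
next
  case False
  then have \<rho>: "0 < \<rho>" using assms by simp
  have "conv_radius a \<ge> ereal (inverse \<rho>)"
  proof (rule conv_radius_geI_ex')
    fix r assume r: "0 < r" "ereal r < ereal (inverse \<rho>)"
    then have "\<rho> * r < 1" using \<rho> by (simp add: field_simps)
    show "summable (\<lambda>n. a n * of_real r ^ n)"
    proof (rule summable_comparison_test')
      show "summable (\<lambda>n. C * (\<rho> * r) ^ n)"
        using \<open>\<rho> * r < 1\<close> \<rho> r by (intro summable_mult summable_geometric) auto
      show "norm (a n * of_real r ^ n) \<le> C * (\<rho> * r) ^ n" for n
      proof -
        have "\<bar>a n\<bar> * r ^ n \<le> C * \<rho> ^ n * r ^ n"
          using assms r by (intro mult_right_mono) auto
        then show ?thesis using r by (simp add: abs_mult power_mult_distrib mult_ac)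
      qed
    qed
  qed
  then have "inverse (conv_radius a) \<le> inverse (ereal (inverse \<rho>))"
    using \<rho> by (intro ereal_inverse_antimono) auto
  then show ?thesis using \<rho> by simp
qed

lemma inverse_conv_radius_walk_weight_le:
  assumes \<gamma>: "0 < \<gamma>" and h: "\<And>x. x \<in> V \<Longrightarrow> 0 < h x" and "0 \<le> \<rho>"
    and eig: "\<And>x. x \<in> V \<Longrightarrow> vertex_weight \<gamma> x * nbr_sum V h x = \<rho> * h x"
    and xy: "x \<in> V" "y \<in> V"
  shows "inverse (conv_radius (\<lambda>n. walk_weight \<gamma> V n x y)) \<le> ereal \<rho>"
proof (rule inverse_conv_radius_le)
  show "\<bar>walk_weight \<gamma> V n x y\<bar> \<le> (h x / h y) * \<rho> ^ n" for n
    using walk_weight_le[of \<gamma> V h \<rho> x y n] assms h[OF xy(2)] walk_weight_nonneg[OF \<gamma>, of V n x y]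
    by (simp add: field_simps)
qed fact

text \<open>The adjacency matrix is self-adjoint with respect to the measure \<open>1 / vertex_weight \<gamma>\<close>,
  so a right eigenvector \<open>h\<close> yields the left eigenvector \<open>h / vertex_weight \<gamma>\<close>.\<close>

lemma sum_nbr_sum_swap:
  assumes "finite V"
  shows "(\<Sum>x\<in>V. f x * nbr_sum V g x) = (\<Sum>x\<in>V. nbr_sum V f x * g x)"
proof -
  \<comment> \<open>Adjacency is written as a condition symmetric in both vertices, so that
    exchanging the sums gives an expression of the same form.\<close>
  have *: "nbr_sum V u x = (\<Sum>z\<in>V. if \<bar>x - z\<bar> = 1 then u z else 0)" for u x
    unfolding nbr_sum_def using assms
    by (simp add: sum.If_cases) (rule sum.cong, auto)
  have "(\<Sum>x\<in>V. f x * nbr_sum V g x) = (\<Sum>x\<in>V. \<Sum>z\<in>V. if \<bar>x - z\<bar> = 1 then f x * g z else 0)"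
    unfolding * sum_distrib_left by (intro sum.cong) auto
  also have "\<dots> = (\<Sum>z\<in>V. \<Sum>x\<in>V. if \<bar>x - z\<bar> = 1 then f x * g z else 0)"
    by (rule sum.swap)
  also have "\<dots> = (\<Sum>x\<in>V. nbr_sum V f x * g x)"
    unfolding * sum_distrib_right by (intro sum.cong) auto
  finally show ?thesis .
qed

text \<open>The left eigenvector relation for powers, read in column \<open>y\<close>. Per step, the
  division by the weight cancels the diagonal factor, self-adjointness moves the neighbour sum onto
  \<open>h\<close>, and the eigenvalue equation yields one factor \<rho>.\<close>

lemma sum_walk_weight:
  assumes \<gamma>: "0 < \<gamma>" and "finite V" "y \<in> V"
    and eig: "\<And>x. x \<in> V \<Longrightarrow> vertex_weight \<gamma> x * nbr_sum V h x = \<rho> * h x"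
  shows "(\<Sum>x\<in>V. h x / vertex_weight \<gamma> x * walk_weight \<gamma> V n x y)
           = \<rho> ^ n * (h y / vertex_weight \<gamma> y)"
proof (induction n)
  case 0
  have "(\<Sum>x\<in>V. h x / vertex_weight \<gamma> x * walk_weight \<gamma> V 0 x y)
      = (\<Sum>x\<in>V. if x = y then h x / vertex_weight \<gamma> x else 0)"
    by (intro sum.cong) auto
  then show ?case using assms by simp
next
  case (Suc n)
  have w: "vertex_weight \<gamma> x \<noteq> 0" for x
    using vertex_weight_pos[OF \<gamma>, of x] by simp
  have "(\<Sum>x\<in>V. h x / vertex_weight \<gamma> x * walk_weight \<gamma> V (Suc n) x y)
      = (\<Sum>x\<in>V. h x * nbr_sum V (\<lambda>z. walk_weight \<gamma> V n z y) x)"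
    using w by (simp add: walk_weight_Suc)
  also have "\<dots> = (\<Sum>x\<in>V. nbr_sum V h x * walk_weight \<gamma> V n x y)"
    using assms by (simp add: sum_nbr_sum_swap)
  also have "\<dots> = (\<Sum>x\<in>V. \<rho> * (h x / vertex_weight \<gamma> x * walk_weight \<gamma> V n x y))"
    using w eig by (intro sum.cong) (auto simp: field_simps)
  also have "\<dots> = \<rho> ^ Suc n * (h y / vertex_weight \<gamma> y)"
    by (subst sum_distrib_left[symmetric], subst Suc) simp
  finally show ?case .
qed

text \<open>Irreducibility of the path: a property that passes along edges spreads from one vertex
  to the whole interval.\<close>

lemma interval_connected_induct:
  fixes a b x0 x :: int
  assumes "x0 \<in> {a..b}" "x \<in> {a..b}" "P x0"
    and step: "\<And>x z. x \<in> {a..b} \<Longrightarrow> z \<in> {a..b} \<Longrightarrow> \<bar>x - z\<bar> = 1 \<Longrightarrow> P x \<Longrightarrow> P z"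
  shows "P x"
proof (cases "x0 \<le> x")
  case True
  then have "x \<le> b \<longrightarrow> P x"
  proof (induction rule: int_ge_induct)
    case (step i)
    then show ?case using assms(1) assms(4)[of i "i + 1"] by auto
  qed (use assms in auto)
  then show ?thesis using assms by simp
next
  case False
  then have "x \<le> x0" by simp
  then have "a \<le> x \<longrightarrow> P x"
  proof (induction rule: int_le_induct)
    case (step i)
    then show ?case using assms(1) assms(4)[of i "i - 1"] by auto
  qed (use assms in auto)
  then show ?thesis using assms by simp
qed

text \<open>If 1/\<rho> lay inside the disc of convergence, the series at 1/\<rho> would converge
  from \<open>x\<close>, hence by connectedness from every vertex. Pairing with the left eigenvector
  would then make a series with constant positive terms summable.\<close>

lemma inverse_conv_radius_walk_weight_ge:
  assumes \<gamma>: "0 < \<gamma>" and h: "\<And>x. x \<in> {a..b} \<Longrightarrow> 0 < h x" and "0 \<le> \<rho>"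
    and eig: "\<And>x. x \<in> {a..b} \<Longrightarrow> vertex_weight \<gamma> x * nbr_sum {a..b} h x = \<rho> * h x"
    and xy: "x \<in> {a..b}" "y \<in> {a..b}"
  shows "ereal \<rho> \<le> inverse (conv_radius (\<lambda>n. walk_weight \<gamma> {a..b} n x y))"
proof (rule ccontr)
  let ?M = "walk_weight \<gamma> {a..b}"
  define R where "R = conv_radius (\<lambda>n. ?M n x y)"
  assume "\<not> ?thesis"
  then have less: "inverse R < ereal \<rho>" by (simp add: R_def)
  have "0 \<le> R" by (simp add: R_def conv_radius_nonneg)
  then have "\<rho> > 0"
    using less by (metis ereal_inverse_nonneg_iff ereal_less(2) order.strict_trans1)
  have "ereal (1 / \<rho>) < R"
    using less \<open>0 \<le> R\<close> \<open>\<rho> > 0\<close> by (cases R) (auto simp: field_simps split: if_splits)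
  then have "summable (\<lambda>n. ?M n x y * (1 / \<rho>) ^ n)"
    using \<open>\<rho> > 0\<close> by (intro summable_in_conv_radius) (auto simp: R_def)
  then have summ: "summable (\<lambda>n. ?M n z y * (1 / \<rho>) ^ n)" if "z \<in> {a..b}" for z
  proof (rule interval_connected_induct[where P = "\<lambda>z. summable (\<lambda>n. ?M n z y * (1 / \<rho>) ^ n)", OF xy(1) that])
    fix u v assume uv: "u \<in> {a..b}" "v \<in> {a..b}" "\<bar>u - v\<bar> = 1"
      and s: "summable (\<lambda>n. ?M n u y * (1 / \<rho>) ^ n)"
    note w = vertex_weight_pos[OF \<gamma>, of u]
    have "summable (\<lambda>n. ?M (Suc n) u y * (1 / \<rho>) ^ Suc n)"
      by (subst summable_Suc_iff) fact
    then have "summable (\<lambda>n. \<rho> / vertex_weight \<gamma> u * (?M (Suc n) u y * (1 / \<rho>) ^ Suc n))"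
      by (rule summable_mult)
    then show "summable (\<lambda>n. ?M n v y * (1 / \<rho>) ^ n)"
    proof (rule summable_comparison_test')
      fix n
      \<comment> \<open>Going from \<open>u\<close> to \<open>v\<close> is one possible first step,
        so each coefficient at \<open>v\<close> is dominated by the next coefficient at
        \<open>u\<close> up to a constant factor.\<close>
      have "?M n v y \<le> nbr_sum {a..b} (\<lambda>z. ?M n z y) u"
        unfolding nbr_sum_def using uv \<gamma>
        by (intro member_le_sum) (auto intro: walk_weight_nonneg)
      also have "\<dots> = ?M (Suc n) u y / vertex_weight \<gamma> u"
        using w by (simp add: walk_weight_Suc)
      finally have "?M n v y * (1 / \<rho>) ^ n \<le> ?M (Suc n) u y / vertex_weight \<gamma> u * (1 / \<rho>) ^ n"
        using \<open>\<rho> > 0\<close> by (intro mult_right_mono) auto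
      also have "\<dots> = \<rho> / vertex_weight \<gamma> u * (?M (Suc n) u y * (1 / \<rho>) ^ Suc n)"
        using \<open>\<rho> > 0\<close> by (simp add: field_simps)
      finally show "norm (?M n v y * (1 / \<rho>) ^ n)
          \<le> \<rho> / vertex_weight \<gamma> u * (?M (Suc n) u y * (1 / \<rho>) ^ Suc n)"
        using \<open>\<rho> > 0\<close> walk_weight_nonneg[OF \<gamma>, of "{a..b}" n v y] by simp
    qed
  qed
  have "summable (\<lambda>n. \<Sum>z\<in>{a..b}. h z / vertex_weight \<gamma> z * (?M n z y * (1 / \<rho>) ^ n))"
    by (intro summable_sum summable_mult summ)
  moreover have "(\<Sum>z\<in>{a..b}. h z / vertex_weight \<gamma> z * (?M n z y * (1 / \<rho>) ^ n))
      = h y / vertex_weight \<gamma> y" for n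
  proof -
    have "(\<Sum>z\<in>{a..b}. h z / vertex_weight \<gamma> z * (?M n z y * (1 / \<rho>) ^ n))
        = (\<Sum>z\<in>{a..b}. h z / vertex_weight \<gamma> z * ?M n z y) * (1 / \<rho>) ^ n"
      by (simp add: sum_distrib_right mult.assoc)
    also have "\<dots> = \<rho> ^ n * (h y / vertex_weight \<gamma> y) * (1 / \<rho>) ^ n"
      by (subst sum_walk_weight[where h = h and \<rho> = \<rho>]) (use assms in auto)
    also have "\<dots> = h y / vertex_weight \<gamma> y"
      using \<open>\<rho> > 0\<close> by (simp add: field_simps)
    finally show ?thesis .
  qed
  ultimately have "h y / vertex_weight \<gamma> y = 0"
    by (simp only: summable_const_iff)
  then show False
    using h[OF xy(2)] vertex_weight_pos[OF \<gamma>, of y] by simp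
qed

lemma comb_spectral_radius_eqI:
  assumes "V \<noteq> {}"
    and "\<And>x y. x \<in> V \<Longrightarrow> y \<in> V \<Longrightarrow> inverse (conv_radius (\<lambda>n. matrix_power V A n x y)) = ereal r"
  shows "comb_spectral_radius V A = r"
  unfolding comb_spectral_radius_def
proof (rule the_equality)
  fix s assume "\<forall>x\<in>V. \<forall>y\<in>V. inverse (conv_radius (\<lambda>n. matrix_power V A n x y)) = ereal s"
  then show "s = r" using assms by fastforce
qed (use assms in auto)

lemma inverse_conv_radius_walk_weight_eq:
  assumes "0 < \<gamma>" "\<And>x. x \<in> {a..b} \<Longrightarrow> 0 < h x" "0 \<le> \<rho>"
    and "\<And>x. x \<in> {a..b} \<Longrightarrow> vertex_weight \<gamma> x * nbr_sum {a..b} h x = \<rho> * h x"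
    and "x \<in> {a..b}" "y \<in> {a..b}"
  shows "inverse (conv_radius (\<lambda>n. walk_weight \<gamma> {a..b} n x y)) = ereal \<rho>"
  using inverse_conv_radius_walk_weight_le[OF assms] inverse_conv_radius_walk_weight_ge[OF assms]
  by (rule antisym)

text \<open>Used to bound the spectral radius of the whole line from below by those of its finite
  intervals.\<close>

lemma inverse_conv_radius_mono:
  fixes f g :: "nat \<Rightarrow> real"
  assumes "\<And>n. 0 \<le> f n" "\<And>n. f n \<le> g n"
  shows "inverse (conv_radius f) \<le> inverse (conv_radius g)"
proof (rule ereal_inverse_antimono)
  show "0 \<le> conv_radius g" by (rule conv_radius_nonneg)
  show "conv_radius g \<le> conv_radius f"
  proof (rule conv_radius_geI_ex)
    fix r assume r: "0 < r" "ereal r < conv_radius g"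
    have "summable (\<lambda>n. g n * r ^ n)"
      using r by (intro summable_in_conv_radius) auto
    then have "summable (\<lambda>n. f n * r ^ n)"
      by (rule summable_comparison_test'[where N = 0])
         (use assms r in \<open>auto simp: abs_mult intro!: mult_right_mono\<close>)
    then show "\<exists>z. norm z = r \<and> summable (\<lambda>n. f n * z ^ n)"
      using r by (intro exI[of _ r]) auto
  qed
qed

section \<open>Eigenfunctions on intervals\<close>

text \<open>The bounds by \<pi> keep all sines in the glued solution positive; they select the root
  of the equation at 0 that belongs to the positive eigenfunction.\<close>

definition principal_angle :: "real \<Rightarrow> int \<Rightarrow> int \<Rightarrow> real \<Rightarrow> bool" where
  "principal_angle \<gamma> p q \<theta> \<longleftrightarrow> 0 < \<theta> \<and> \<theta> * p < pi \<and> \<theta> * q < pi \<and>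
     cot (\<theta> * p) + cot (\<theta> * q) + Lam \<gamma> * cot \<theta> = 0"

lemma principal_angle_commute: "principal_angle \<gamma> p q \<theta> \<longleftrightarrow> principal_angle \<gamma> q p \<theta>"
  by (auto simp: principal_angle_def)

lemma cot_antimono:
  assumes "0 < x" "x \<le> y" "y < pi"
  shows "cot y \<le> cot x"
proof -
  have "0 < sin x" "0 < sin y" "0 \<le> sin (y - x)"
    using assms by (auto intro!: sin_gt_zero sin_ge_zero)
  then show ?thesis
    by (simp add: cot_def field_simps sin_diff)
qed

lemma cot_nonneg: "0 < x \<Longrightarrow> x \<le> pi / 2 \<Longrightarrow> 0 \<le> cot x"
  unfolding cot_def by (intro divide_nonneg_nonneg sin_ge_zero cos_ge_zero) (use pi_gt_zero in linarith)+

text \<open>Intermediate value theorem: at \<theta> = \<pi>/(2p) the first cotangent vanishes and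
  the other terms are nonnegative; close to \<pi>/p the first cotangent is so negative that it
  outweighs the rest.\<close>

lemma principal_angle_exists_le:
  assumes L: "0 \<le> Lam \<gamma>" and pq: "1 \<le> q" "q \<le> p"
  shows "\<exists>\<theta>. principal_angle \<gamma> p q \<theta>"
proof -
  define L where "L = Lam \<gamma>"
  define g where "g \<theta> = cot (\<theta> * p) + cot (\<theta> * q) + L * cot \<theta>" for \<theta> :: real
  define a where "a = pi / (2 * p)"
  \<comment> \<open>An upper bound for the two remaining terms anywhere to the right of
    \<open>a\<close>, since the cotangent decreases.\<close>
  define C where "C = (1 + L) * cot a"
  have p: "1 \<le> real_of_int p" and q: "1 \<le> real_of_int q" and qp: "real_of_int q \<le> real_of_int p"
    using pq by simp_all
  have "0 \<le> L" using L by (simp add: L_def)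
  have a: "0 < a" "a * p = pi / 2" "a \<le> pi / 2"
    using p by (auto simp: a_def field_simps)
  have "a * q \<le> a * p" using a qp by simp
  then have aq: "a * q \<le> pi / 2" "0 < a * q"
    using a q by auto
  have "0 \<le> cot a" using a by (intro cot_nonneg)
  then have C: "0 \<le> C" using \<open>0 \<le> L\<close> by (simp add: C_def)
  \<comment> \<open>Chosen so that cot \<alpha> = C + 1; then cot (b p) = - (C + 1) beats the bound
    \<open>C\<close> on the other terms.\<close>
  define \<alpha> where "\<alpha> = arctan (1 / (C + 1))"
  have \<alpha>: "0 < \<alpha>" "\<alpha> < pi / 2"
    using C arctan_ubound by (auto simp: \<alpha>_def)
  have cot\<alpha>: "cot \<alpha> = C + 1"
    by (simp add: \<alpha>_def cot_altdef tan_arctan)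
  define b where "b = (pi - \<alpha>) / p"
  have bp: "b * p = pi - \<alpha>" using p by (simp add: b_def)
  have "0 < b" using p \<alpha> by (simp add: b_def)
  have "a * p < b * p" using a bp \<alpha> by simp
  then have ab: "a < b" using p by simp
  have mult_q: "x \<le> x * q" "x * q \<le> x * p" "x \<le> x * p" if "0 \<le> x" for x :: real
    using that p q qp by (auto simp: mult_left_mono mult_le_cancel_left1)
  have b: "a \<le> b" "b \<le> b * q" "b * q < pi" "b < pi"
    using mult_q(1,2)[of b] ab \<open>0 < b\<close> bp \<alpha> by linarith+
  then have "cot (b * q) \<le> cot a" "cot b \<le> cot a"
    using \<open>0 < a\<close> by (simp_all only: cot_antimono order_trans[of a b])
  then have "g b \<le> cot (b * p) + cot a + L * cot a"
    unfolding g_def using \<open>0 \<le> L\<close> by (intro add_mono mult_left_mono order_refl)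
  also have "cot (b * p) = - cot \<alpha>"
    unfolding bp by (simp add: cot_def)
  finally have gb: "g b \<le> 0"
    using cot\<alpha> by (simp add: C_def algebra_simps)
  have "cot (a * p) = 0" unfolding a(2) by (simp add: cot_def)
  moreover have "0 \<le> cot (a * q)" by (intro cot_nonneg aq)
  ultimately have ga: "0 \<le> g a"
    using \<open>0 \<le> L\<close> \<open>0 \<le> cot a\<close> by (simp add: g_def)
  \<comment> \<open>No sine vanishes on the interval, so all three cotangents are continuous
    there.\<close>
  have sin_pos: "0 < sin x" "0 < sin (x * q)" "0 < sin (x * p)" if "a \<le> x" "x \<le> b" for x :: real
  proof -
    have "x * p \<le> b * p" using that p by simp
    then have "x * p < pi" using bp \<alpha> by simp
    moreover have "0 < x" using that a by linarith
    moreover have "x \<le> x * q" "x * q \<le> x * p"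
      using mult_q(1,2)[of x] \<open>0 < x\<close> by simp_all
    ultimately have "x < pi" "x * q < pi" "0 < x * q" "0 < x * p" by linarith+
    then show "0 < sin x" "0 < sin (x * q)" "0 < sin (x * p)"
      using \<open>0 < x\<close> \<open>x * p < pi\<close> by (auto intro: sin_gt_zero)
  qed
  have "continuous_on {a..b} g"
    unfolding g_def by (intro continuous_intros) (use sin_pos in force)+
  then obtain \<theta> where \<theta>: "a \<le> \<theta>" "\<theta> \<le> b" "g \<theta> = 0"
    using IVT2'[of g b 0 a] ga gb ab by auto
  have "\<theta> * p \<le> b * p" using \<theta> p by simp
  then have "\<theta> * p < pi" using bp \<alpha> by simp
  moreover have "0 < \<theta>" using \<theta> a by linarith
  moreover have "\<theta> * q < pi"
    using order.strict_trans1[OF mult_q(2)] \<open>\<theta> * p < pi\<close> \<open>0 < \<theta>\<close> by (meson less_imp_le)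
  ultimately have "principal_angle \<gamma> p q \<theta>"
    using \<open>g \<theta> = 0\<close> by (simp add: principal_angle_def g_def L_def)
  then show ?thesis ..
qed

lemma principal_angle_exists:
  assumes "0 < \<gamma>" "\<gamma> < 1" "1 \<le> p" "1 \<le> q"
  shows "\<exists>\<theta>. principal_angle \<gamma> p q \<theta>"
  using principal_angle_exists_le[of \<gamma> q p] principal_angle_exists_le[of \<gamma> p q]
    Lam_pos[OF assms(1,2)] assms
  by (cases "q \<le> p") (auto simp: principal_angle_commute)

text \<open>The \<open>max\<close> makes the function vanish from \<open>p\<close> onwards, in
  accordance with the extension by zero; the denominator normalizes the value at 0 to 1.\<close>

definition ray_sine :: "int \<Rightarrow> real \<Rightarrow> int \<Rightarrow> real" where
  "ray_sine p \<theta> n = sin (\<theta> * real_of_int (max 0 (p - n))) / sin (\<theta> * p)"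

definition glued_sine :: "int \<Rightarrow> int \<Rightarrow> real \<Rightarrow> int \<Rightarrow> real" where
  "glued_sine p q \<theta> n = (if 0 \<le> n then ray_sine p \<theta> n else ray_sine q \<theta> (- n))"

lemma ray_sine_0: "1 \<le> p \<Longrightarrow> sin (\<theta> * p) \<noteq> 0 \<Longrightarrow> ray_sine p \<theta> 0 = 1"
  by (simp add: ray_sine_def)

lemma ray_sine_eq_0: "p \<le> n \<Longrightarrow> ray_sine p \<theta> n = 0"
  by (simp add: ray_sine_def max_def)

text \<open>This is sin (m + \<theta>) + sin (m - \<theta>) = 2 cos \<theta> sin m. For n < p all
  three arguments are nonnegative, so the truncation is inactive; at n = p - 1 the right neighbour
  is the zero at \<open>p\<close>.\<close>

lemma ray_sine_recurrence:
  assumes "n < p"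
  shows "ray_sine p \<theta> (n - 1) + ray_sine p \<theta> (n + 1) = 2 * cos \<theta> * ray_sine p \<theta> n"
proof -
  define m where "m = \<theta> * (real_of_int p - real_of_int n)"
  have "\<theta> * (real_of_int p - (real_of_int n - 1)) = m + \<theta>"
    "\<theta> * (real_of_int p - (real_of_int n + 1)) = m - \<theta>"
    by (simp_all add: m_def algebra_simps)
  then show ?thesis
    using assms by (simp add: ray_sine_def max_def m_def[symmetric] sin_add sin_diff flip: add_divide_distrib)
qed

text \<open>Isolates cot (\<theta> p), which enters both the equation at 0 and the passage to the
  limit.\<close>

lemma ray_sine_expand:
  assumes "n \<le> p" "sin (\<theta> * p) \<noteq> 0"
  shows "ray_sine p \<theta> n = cos (\<theta> * n) - sin (\<theta> * n) * cot (\<theta> * p)"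
  using assms by (simp add: ray_sine_def cot_def right_diff_distrib sin_diff field_simps)

lemma sine_step:
  fixes a c t :: real
  shows "2 * cos t * (c * sin a) - c * sin (a - t) = c * sin (a + t)"
  by (simp add: sin_add sin_diff algebra_simps)

text \<open>The recurrence is run backwards from the zero at \<open>p\<close>: f (p - k) is
  proportional to sin (k \<theta>), with f (p - 1) as free constant. Comparing k = p - n with k = p
  eliminates that constant.\<close>

lemma ray_sine_unique:
  fixes f :: "int \<Rightarrow> real"
  assumes "f p = 0" "sin \<theta> \<noteq> 0" "sin (\<theta> * p) \<noteq> 0"
    and rec: "\<And>n. 1 \<le> n \<Longrightarrow> n < p \<Longrightarrow> f (n - 1) + f (n + 1) = 2 * cos \<theta> * f n"
    and n: "0 \<le> n" "n \<le> p"
  shows "f n = f 0 * ray_sine p \<theta> n"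
proof -
  have *: "int k \<le> p \<longrightarrow> f (p - int k) * sin \<theta> = f (p - 1) * sin (\<theta> * int k)" for k
  proof (induction k rule: induct_nat_012)
    case (ge2 k)
    show ?case
    proof
      assume k: "int (Suc (Suc k)) \<le> p"
      have "f (p - int (Suc (Suc k))) = 2 * cos \<theta> * f (p - int (Suc k)) - f (p - int k)"
        using rec[of "p - int (Suc k)"] k by (simp add: algebra_simps)
      then have "f (p - int (Suc (Suc k))) * sin \<theta>
          = 2 * cos \<theta> * (f (p - 1) * sin (\<theta> * int (Suc k))) - f (p - 1) * sin (\<theta> * int k)"
      proof -
        have "f (p - int k) * sin \<theta> = f (p - 1) * sin (\<theta> * int k)"
          and "f (p - int (Suc k)) * sin \<theta> = f (p - 1) * sin (\<theta> * int (Suc k))"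
          using ge2 k by auto
        then show ?thesis
          using \<open>f (p - int (Suc (Suc k))) = _\<close>
          by (simp only: left_diff_distrib mult.assoc)
      qed
      also have "sin (\<theta> * int k) = sin (\<theta> * int (Suc k) - \<theta>)"
        by (simp add: algebra_simps)
      also have "2 * cos \<theta> * (f (p - 1) * sin (\<theta> * int (Suc k))) - f (p - 1) * sin (\<theta> * int (Suc k) - \<theta>)
          = f (p - 1) * sin (\<theta> * int (Suc k) + \<theta>)"
        by (rule sine_step)
      also have "\<theta> * int (Suc k) + \<theta> = \<theta> * int (Suc (Suc k))"
        by (simp add: algebra_simps)
      finally show "f (p - int (Suc (Suc k))) * sin \<theta> = f (p - 1) * sin (\<theta> * int (Suc (Suc k)))" .
    qed
  qed (use assms(1) in auto)
  have 1: "f n * sin \<theta> = f (p - 1) * sin (\<theta> * (p - n))"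
    using *[of "nat (p - n)"] n by simp
  have 2: "f 0 * sin \<theta> = f (p - 1) * sin (\<theta> * p)"
    using *[of "nat p"] n by simp
  have "(f n * sin (\<theta> * p)) * sin \<theta> = (f 0 * sin (\<theta> * (p - n))) * sin \<theta>"
  proof -
    have "(f n * sin (\<theta> * p)) * sin \<theta> = (f n * sin \<theta>) * sin (\<theta> * p)"
      by (rule mult.commute[THEN trans]) simp
    also have "\<dots> = (f (p - 1) * sin (\<theta> * p)) * sin (\<theta> * (p - n))"
      unfolding 1 by simp
    also have "\<dots> = (f 0 * sin (\<theta> * (p - n))) * sin \<theta>"
      unfolding 2[symmetric] by simp
    finally show ?thesis .
  qed
  then show ?thesis
    using assms n by (simp add: ray_sine_def max_def field_simps)
qed

section \<open>The positive eigenfunction of a finite interval and its eigenvalue\<close>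

locale boundary_angle =
  fixes \<gamma> :: real and p q :: int and \<theta> :: real
  assumes \<gamma>: "0 < \<gamma>" "\<gamma> < 1" and pq: "1 \<le> p" "1 \<le> q"
    and angle: "principal_angle \<gamma> p q \<theta>"
begin

lemma angle_pos: "0 < \<theta>" and angle_p: "\<theta> * p < pi" and angle_q: "\<theta> * q < pi"
  and cot_eq: "cot (\<theta> * p) + cot (\<theta> * q) + Lam \<gamma> * cot \<theta> = 0"
  using angle by (auto simp: principal_angle_def)

lemma angle_le_mult: "\<theta> \<le> \<theta> * p" "\<theta> \<le> \<theta> * q"
  using angle_pos pq by (auto simp: mult_le_cancel_left1)

lemma sin_angle_pos: "0 < sin \<theta>" "0 < sin (\<theta> * p)" "0 < sin (\<theta> * q)"
  proof -
  have "\<theta> < pi" using angle_p angle_le_mult by linarith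
  then show "0 < sin \<theta>" "0 < sin (\<theta> * p)" "0 < sin (\<theta> * q)"
    using angle_pos angle_p angle_q pq by (auto intro!: sin_gt_zero)
qed

text \<open>If an end is at distance at least 2, then 2 \<theta> < \<pi>. For the single vertex the
  defining equation forces cot \<theta> = 0, that is, spectral radius 0.\<close>

lemma cos_angle_nonneg: "0 \<le> cos \<theta>"
proof (cases "p = 1 \<and> q = 1")
  case True
  then have "(2 + Lam \<gamma>) * cot \<theta> = 0"
    using cot_eq by (simp add: algebra_simps)
  then have "cot \<theta> = 0" using Lam_pos[OF \<gamma>] by simp
  then show ?thesis using sin_angle_pos by (simp add: cot_def)
next
  case False
  then have "2 \<le> real_of_int p \<or> 2 \<le> real_of_int q" using pq by auto
  then have "\<theta> * 2 \<le> \<theta> * p \<or> \<theta> * 2 \<le> \<theta> * q"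
    using angle_pos by simp
  then have "\<theta> * 2 < pi" using angle_p angle_q by linarith
  then show ?thesis using angle_pos by (intro cos_ge_zero) auto
qed

lemma glued_sine_pos:
  assumes "n \<in> H p q"
  shows "0 < glued_sine p q \<theta> n"
proof -
  have *: "0 < ray_sine r \<theta> m" if "0 \<le> m" "m < r" "\<theta> * r < pi" "0 < sin (\<theta> * r)" for r m
  proof -
    have "\<theta> * (real_of_int r - real_of_int m) \<le> \<theta> * r"
      using angle_pos that by (intro mult_left_mono) auto
    then have "0 < sin (\<theta> * (real_of_int r - real_of_int m))"
      using that angle_pos by (intro sin_gt_zero mult_pos_pos) linarith+
    then show ?thesis using that by (simp add: ray_sine_def max_def)
  qed
  show ?thesis
    using assms angle_p angle_q sin_angle_pos by (auto simp: glued_sine_def H_def intro!: *)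
qed

lemma glued_sine_eq_0: "n \<notin> H p q \<Longrightarrow> glued_sine p q \<theta> n = 0"
  using pq by (auto simp: glued_sine_def H_def intro!: ray_sine_eq_0)

lemma glued_sine_eigen:
  assumes "x \<in> H p q"
  shows "vertex_weight \<gamma> x * nbr_sum (H p q) (glued_sine p q \<theta>) x = 2 * cos \<theta> * glued_sine p q \<theta> x"
proof -
  have s: "nbr_sum (H p q) (glued_sine p q \<theta>) x = glued_sine p q \<theta> (x - 1) + glued_sine p q \<theta> (x + 1)"
    by (rule nbr_sum_supported) (rule glued_sine_eq_0)
  have one: "ray_sine p \<theta> 0 = 1" "ray_sine q \<theta> 0 = 1"
    using pq sin_angle_pos by (auto simp: ray_sine_0)
  consider "x = 0" | "x > 0" | "x < 0" by linarith
  then show ?thesis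
  proof cases
    case 1
    \<comment> \<open>The equation for the principal angle is exactly the eigenvalue equation at 0,
      because \<gamma> (2 + \<Lambda>) = 2.\<close>
    have "ray_sine p \<theta> 1 + ray_sine q \<theta> 1 = 2 * cos \<theta> - sin \<theta> * (cot (\<theta> * p) + cot (\<theta> * q))"
      using pq sin_angle_pos by (simp add: ray_sine_expand algebra_simps)
    also have "cot (\<theta> * p) + cot (\<theta> * q) = - Lam \<gamma> * cot \<theta>"
      using cot_eq by simp
    also have "sin \<theta> * (- Lam \<gamma> * cot \<theta>) = - Lam \<gamma> * cos \<theta>"
      using sin_angle_pos by (simp add: cot_def)
    finally have "\<gamma> * (ray_sine p \<theta> 1 + ray_sine q \<theta> 1) = 2 * cos \<theta>"
      using \<gamma> by (simp add: Lam_def field_simps)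
    then show ?thesis
      using s unfolding 1 by (simp add: vertex_weight_def glued_sine_def one add.commute)
  next
    case 2
    then show ?thesis
      using assms ray_sine_recurrence[of x p \<theta>]
      unfolding s by (simp add: vertex_weight_def glued_sine_def H_def)
  next
    case 3
    have rec: "ray_sine q \<theta> (- x - 1) + ray_sine q \<theta> (- x + 1) = 2 * cos \<theta> * ray_sine q \<theta> (- x)"
      using assms by (intro ray_sine_recurrence) (auto simp: H_def)
    \<comment> \<open>At x = -1 the right neighbour 0 belongs to the other branch; both branches
      equal 1 there.\<close>
    have "glued_sine p q \<theta> (x + 1) = ray_sine q \<theta> (- x - 1)"
      using one 3 by (cases "x = - 1") (auto simp: glued_sine_def)
    moreover have "glued_sine p q \<theta> (x - 1) = ray_sine q \<theta> (- x + 1)"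
      using 3 by (simp add: glued_sine_def)
    moreover have "glued_sine p q \<theta> x = ray_sine q \<theta> (- x)" "vertex_weight \<gamma> x = 1"
      using 3 by (auto simp: glued_sine_def vertex_weight_def)
    ultimately show ?thesis
      unfolding s using rec
      by (simp only: mult_1_left add.commute[of "ray_sine q \<theta> (- x + 1)"])
  qed
qed

lemma inverse_conv_radius_H:
  assumes "x \<in> H p q" "y \<in> H p q"
  shows "inverse (conv_radius (\<lambda>n. walk_weight \<gamma> (H p q) n x y)) = ereal (2 * cos \<theta>)"
  using assms glued_sine_pos glued_sine_eigen cos_angle_nonneg \<gamma> unfolding H_def
  by (intro inverse_conv_radius_walk_weight_eq[where h = "glued_sine p q \<theta>"]) auto

lemma spectral_radius_H: "comb_spectral_radius (H p q) (adjacency \<gamma>) = 2 * cos \<theta>"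
  using pq by (intro comb_spectral_radius_eqI inverse_conv_radius_H) (auto simp: H_def)

text \<open>Uniqueness: off 0 the equation is the three-term recurrence, and on each side the zero
  at the far end and the value 1 at 0 determine the solution by
  \<open>ray_sine_unique\<close>.\<close>

lemma is_psi_pq_iff: "is_psi_pq \<gamma> p q \<psi> \<longleftrightarrow> \<psi> = glued_sine p q \<theta>"
proof
  have "rho_eigenfunction (H p q) (adjacency \<gamma>) (glued_sine p q \<theta>)"
    unfolding rho_eigenfunction_adjacency_iff spectral_radius_H using glued_sine_eigen by blast
  moreover have "glued_sine p q \<theta> 0 = 1"
    using pq sin_angle_pos by (simp add: glued_sine_def ray_sine_0)
  ultimately show "is_psi_pq \<gamma> p q \<psi>" if "\<psi> = glued_sine p q \<theta>"
    using that by (simp add: is_psi_pq_def glued_sine_eq_0)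
next
  assume "is_psi_pq \<gamma> p q \<psi>"
  then have eig: "\<And>x. x \<in> H p q \<Longrightarrow> vertex_weight \<gamma> x * nbr_sum (H p q) \<psi> x = 2 * cos \<theta> * \<psi> x"
    and \<psi>0: "\<psi> 0 = 1" and out: "\<And>n. n \<notin> H p q \<Longrightarrow> \<psi> n = 0"
    unfolding is_psi_pq_def rho_eigenfunction_adjacency_iff spectral_radius_H by auto
  have rec: "\<psi> (x - 1) + \<psi> (x + 1) = 2 * cos \<theta> * \<psi> x" if "x \<in> H p q" "x \<noteq> 0" for x
    using eig[OF that(1)] that nbr_sum_supported[of "H p q" \<psi> x, OF out] by (simp add: vertex_weight_def)
  have right: "\<psi> n = ray_sine p \<theta> n" if "0 \<le> n" for n
  proof (cases "n \<le> p")
    case True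
    have "\<psi> n = \<psi> 0 * ray_sine p \<theta> n"
      by (rule ray_sine_unique[where f = \<psi>])
         (use that True pq sin_angle_pos rec out in \<open>auto simp: H_def\<close>)
    then show ?thesis using \<psi>0 by simp
  next
    case False
    then show ?thesis using out[of n] by (simp add: H_def ray_sine_eq_0)
  qed
  have left: "\<psi> (- n) = ray_sine q \<theta> n" if "0 \<le> n" for n
  proof (cases "n \<le> q")
    case True
    have "\<psi> (- n) = \<psi> (- 0) * ray_sine q \<theta> n"
    proof (rule ray_sine_unique[where f = "\<lambda>n. \<psi> (- n)"])
      fix m assume "1 \<le> m" "m < q"
      then have "\<psi> (- m - 1) + \<psi> (- m + 1) = 2 * cos \<theta> * \<psi> (- m)"
        using pq by (intro rec) (auto simp: H_def)
      moreover have "- (m - 1) = - m + 1" "- (m + 1) = - m - 1" by simp_all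
      ultimately show "\<psi> (- (m - 1)) + \<psi> (- (m + 1)) = 2 * cos \<theta> * \<psi> (- m)"
        by (simp only: add.commute[of "\<psi> (- m + 1)"])
    qed (use that True pq sin_angle_pos out in \<open>auto simp: H_def\<close>)
    then show ?thesis using \<psi>0 by simp
  next
    case False
    then show ?thesis using out[of "- n"] by (simp add: H_def ray_sine_eq_0)
  qed
  show "\<psi> = glued_sine p q \<theta>"
    using right left[of "- n" for n] by (auto simp: glued_sine_def fun_eq_iff)
qed

lemma psi_pq_eq: "psi_pq \<gamma> p q = glued_sine p q \<theta>"
  by (simp add: psi_pq_def is_psi_pq_iff)

end

section \<open>Positive eigenfunctions and spectral radius of the whole line\<close>

lemma psi_plus_pos: "0 < \<gamma> \<Longrightarrow> \<gamma> < 1 \<Longrightarrow> 0 < psi_plus \<gamma> n"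
  using Lam_pos[of \<gamma>] by (simp add: psi_plus_def add_pos_nonneg)

lemma psi_minus_eq: "psi_minus \<gamma> n = psi_plus \<gamma> (- n)"
  by (simp add: psi_plus_def psi_minus_def)

lemma psi_plus_eigen:
  assumes "0 < \<gamma>" "\<gamma> < 1"
  shows "vertex_weight \<gamma> x * (psi_plus \<gamma> (x - 1) + psi_plus \<gamma> (x + 1)) = 2 * psi_plus \<gamma> x"
proof -
  \<comment> \<open>The eigenvalue equation at 0; it dictates the slope \<Lambda>. Elsewhere the
    function is locally affine.\<close>
  have "\<gamma> * (2 + Lam \<gamma>) = 2" using assms by (simp add: Lam_def field_simps)
  then show ?thesis
    by (cases "x = 0"; cases "x = -1") (auto simp: psi_plus_def vertex_weight_def algebra_simps)
qed

lemma psi_minus_eigen: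
  assumes "0 < \<gamma>" "\<gamma> < 1"
  shows "vertex_weight \<gamma> x * (psi_minus \<gamma> (x - 1) + psi_minus \<gamma> (x + 1)) = 2 * psi_minus \<gamma> x"
proof -
  have "- (x - 1) = - x + 1" "- (x + 1) = - x - 1" by simp_all
  then show ?thesis
    using psi_plus_eigen[OF assms, of "- x"]
    by (simp only: psi_minus_eq vertex_weight_def neg_equal_0_iff_equal
        add.commute[of "psi_plus \<gamma> (- x - 1)"])
qed

text \<open>The positive eigenfunction \<open>psi_plus\<close> with eigenvalue 2 gives the upper
  bound. From below, the symmetric intervals have radius 2 cos \<theta> with \<theta> < \<pi>/n,
  hence at least 2 cos (\<pi>/n).\<close>

lemma spectral_radius_UNIV:
  assumes \<gamma>: "0 < \<gamma>" "\<gamma> < 1"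
  shows "comb_spectral_radius UNIV (adjacency \<gamma>) = 2"
proof (rule comb_spectral_radius_eqI)
  fix x y :: int
  let ?r = "inverse (conv_radius (\<lambda>n. walk_weight \<gamma> UNIV n x y))"
  have "?r \<le> ereal 2"
    using \<gamma> psi_plus_pos psi_plus_eigen
    by (intro inverse_conv_radius_walk_weight_le[where h = "psi_plus \<gamma>"]) (auto simp: nbr_sum_UNIV)
  moreover have "ereal 2 \<le> ?r"
  proof (rule LIMSEQ_le_const2)
    have "(\<lambda>n. 2 * cos (pi / real n)) \<longlonglongrightarrow> 2"
      by real_asymp
    then show "(\<lambda>n. ereal (2 * cos (pi / real n))) \<longlonglongrightarrow> ereal 2"
      by (rule tendsto_ereal)
    show "\<exists>N. \<forall>n\<ge>N. ereal (2 * cos (pi / real n)) \<le> ?r"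
    proof (intro exI allI impI)
      \<comment> \<open>The threshold puts both vertices into \<open>H n n\<close>, whose extreme
        points are at distance n - 1 from 0.\<close>
      fix n assume n: "n \<ge> nat (\<bar>x\<bar> + \<bar>y\<bar> + 1)"
      define k where "k = int n"
      have k: "1 \<le> k" and xy: "x \<in> H k k" "y \<in> H k k"
        using n by (auto simp: k_def H_def)
      obtain \<theta> where "principal_angle \<gamma> k k \<theta>"
        using principal_angle_exists \<gamma> k by blast
      then interpret boundary_angle \<gamma> k k \<theta>
        by unfold_locales (use \<gamma> k in auto)
      have "\<theta> \<le> pi / real n"
        using angle_p k by (simp add: k_def field_simps)
      moreover have "pi / real n \<le> pi"
        using k by (simp add: k_def field_simps)
      ultimately have "cos (pi / real n) \<le> cos \<theta>"
        using angle_pos by (intro cos_monotone_0_pi_le) auto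
      then have "ereal (2 * cos (pi / real n)) \<le> ereal (2 * cos \<theta>)"
        by simp
      also have "\<dots> = inverse (conv_radius (\<lambda>n. walk_weight \<gamma> (H k k) n x y))"
        by (rule inverse_conv_radius_H[OF xy, symmetric])
      also have "\<dots> \<le> ?r"
        using \<gamma> by (intro inverse_conv_radius_mono walk_weight_nonneg walk_weight_mono) auto
      finally show "ereal (2 * cos (pi / real n)) \<le> ?r" .
    qed
  qed
  ultimately show "?r = ereal 2" by (rule antisym)
qed simp

section \<open>Asymptotics of the eigenfunctions\<close>

text \<open>Equivalent to x cos x \<le> sin x, which holds because sin t - t cos t vanishes at 0 and
  has derivative t sin t.\<close>

lemma cot_le_inverse:
  assumes "0 < x" "x < pi"
  shows "cot x \<le> 1 / x"
proof -
  have "sin 0 - 0 * cos 0 \<le> sin x - x * cos x"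
  proof (rule DERIV_nonneg_imp_nondecreasing[where f = "\<lambda>t. sin t - t * cos t"])
    fix t assume "0 \<le> t" "t \<le> x"
    then have "0 \<le> t * sin t" using assms by (intro mult_nonneg_nonneg sin_ge_zero) auto
    moreover have "((\<lambda>t. sin t - t * cos t) has_real_derivative t * sin t) (at t)"
      by (auto intro!: derivative_eq_intros)
    ultimately show "\<exists>y. ((\<lambda>t. sin t - t * cos t) has_real_derivative y) (at t) \<and> 0 \<le> y"
      by blast
  qed (use assms in simp)
  moreover have "0 < sin x" using assms by (rule sin_gt_zero)
  ultimately show ?thesis using assms by (simp add: cot_def field_simps)
qed

lemma cot_diff:
  fixes a b :: real
  assumes "sin a \<noteq> 0" "sin b \<noteq> 0" "sin (a - b) \<noteq> 0"
  shows "cot a * cot b + 1 = cot (a - b) * (cot b - cot a)"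
proof -
  have "cot b - cot a = sin (a - b) / (sin a * sin b)"
    using assms by (simp add: cot_def sin_diff field_simps)
  moreover have "cot a * cot b + 1 = cos (a - b) / (sin a * sin b)"
    using assms by (simp add: cot_def cos_diff field_simps)
  ultimately show ?thesis
    using assms by (simp add: cot_def)
qed

section \<open>The share of the left half and its quadratic equation\<close>

locale small_boundary_angle = boundary_angle +
  assumes angle_small: "\<theta> < pi / 2"
begin

text \<open>This quantity converges to \<open>1 - mu \<gamma> \<delta>\<close>, the weight of \<open>psi_minus\<close> in the limit.\<close>

definition left_share :: real where
  "left_share = - (tan \<theta> * cot (\<theta> * q)) / Lam \<gamma>"

lemma tan_angle_pos: "0 < tan \<theta>"
  using angle_pos angle_small by (rule tan_gt_zero)

lemma Lam_positive: "0 < Lam \<gamma>"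
  using \<gamma> by (rule Lam_pos)

lemma one_minus_left_share: "1 - left_share = - (tan \<theta> * cot (\<theta> * p)) / Lam \<gamma>"
proof -
  have "tan \<theta> * (cot (\<theta> * p) + cot (\<theta> * q) + Lam \<gamma> * cot \<theta>) = 0"
    using cot_eq by simp
  moreover have "tan \<theta> * cot \<theta> = 1"
    using tan_angle_pos by (simp add: cot_altdef)
  ultimately have "tan \<theta> * cot (\<theta> * p) + tan \<theta> * cot (\<theta> * q) + Lam \<gamma> = 0"
    by (simp add: algebra_simps)
  then have "- (tan \<theta> * cot (\<theta> * p)) = tan \<theta> * cot (\<theta> * q) + Lam \<gamma>"
    by linarith
  then show ?thesis
    using Lam_positive by (simp only: left_share_def) (simp add: add_divide_distrib)
qed

text \<open>In this form the limit for \<theta> to 0 is visible: the cosine tends to 1 and the sine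
  quotient to \<open>n\<close>.\<close>

lemma ray_sine_right:
  assumes "n \<le> p"
  shows "ray_sine p \<theta> n = cos (\<theta> * n) + sin (\<theta> * n) / tan \<theta> * (Lam \<gamma> * (1 - left_share))"
  unfolding one_minus_left_share
  using assms sin_angle_pos tan_angle_pos Lam_positive by (simp add: ray_sine_expand)

lemma ray_sine_left:
  assumes "n \<le> q"
  shows "ray_sine q \<theta> n = cos (\<theta> * n) + sin (\<theta> * n) / tan \<theta> * (Lam \<gamma> * left_share)"
  using assms sin_angle_pos tan_angle_pos Lam_positive
  by (simp add: ray_sine_expand left_share_def)

text \<open>The cotangent decreases, so the longer right side has the larger share. This later
  singles out the root below 1/2 of the limiting quadratic.\<close>

lemma left_share_le:
  assumes "q \<le> p"
  shows "left_share \<le> 1 / 2"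
proof -
  have "cot (\<theta> * p) \<le> cot (\<theta> * q)"
    using assms pq angle_pos angle_p by (intro cot_antimono) auto
  then have "left_share \<le> 1 - left_share"
    unfolding one_minus_left_share unfolding left_share_def
    using tan_angle_pos Lam_positive by (intro divide_right_mono) auto
  then show ?thesis by simp
qed

lemma cot_angle_q_le: "tan \<theta> * cot (\<theta> * q) \<le> tan \<theta> / \<theta> / q"
proof -
  have "cot (\<theta> * q) \<le> 1 / (\<theta> * q)"
    using pq angle_pos angle_q by (intro cot_le_inverse) auto
  then have "tan \<theta> * cot (\<theta> * q) \<le> tan \<theta> * (1 / (\<theta> * q))"
    using tan_angle_pos by (intro mult_left_mono) auto
  then show ?thesis by simp
qed

text \<open>Replaces nonnegativity, which can fail for finite intervals (as when \<theta> q <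
  \<pi>/2); the bound vanishes as \<open>q\<close> grows.\<close>

lemma left_share_ge: "- (tan \<theta> / \<theta> / q) / Lam \<gamma> \<le> left_share"
  unfolding left_share_def using cot_angle_q_le Lam_positive by (intro divide_right_mono) auto

definition gap_coeff :: real where
  "gap_coeff = tan \<theta> * cot (\<theta> * real_of_int (p - q))"

lemma angle_gap:
  assumes "q < p"
  shows "0 < \<theta> * real_of_int (p - q)" "\<theta> * real_of_int (p - q) \<le> pi - \<theta> * q" "\<theta> * real_of_int (p - q) < pi"
    "pi - \<theta> * q < pi"
proof -
  have "0 < \<theta> * q" using angle_pos pq by simp
  then show "\<theta> * real_of_int (p - q) \<le> pi - \<theta> * q" "\<theta> * real_of_int (p - q) < pi"
    "pi - \<theta> * q < pi"
    using angle_p by (auto simp: algebra_simps)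
qed (use assms angle_pos in simp)

text \<open>Eliminates the separate cotangents: \<open>p\<close> and \<open>q\<close> enter only
  through \<theta> and their difference, the latter inside \<open>gap_coeff\<close>.\<close>

lemma left_share_quadratic:
  assumes "q < p"
  shows "Lam \<gamma> * left_share * (1 - left_share) + (tan \<theta>)\<^sup>2 / Lam \<gamma> = (1 - 2 * left_share) * gap_coeff"
proof -
  define a b where "a = \<theta> * real_of_int p" and "b = \<theta> * real_of_int q"
  have ab: "a - b = \<theta> * real_of_int (p - q)" by (simp add: a_def b_def algebra_simps)
  have "0 < sin (a - b)"
    unfolding ab using angle_gap[OF assms] by (intro sin_gt_zero) auto
  then have c: "cot a * cot b + 1 = cot (a - b) * (cot b - cot a)"
    using sin_angle_pos by (intro cot_diff) (auto simp: a_def b_def)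
  have y: "Lam \<gamma> * left_share = - (tan \<theta> * cot b)"
    and x: "Lam \<gamma> * (1 - left_share) = - (tan \<theta> * cot a)"
    using Lam_positive by (simp_all only: one_minus_left_share) (simp_all add: left_share_def a_def b_def)
  have "Lam \<gamma> * (Lam \<gamma> * left_share * (1 - left_share) + (tan \<theta>)\<^sup>2 / Lam \<gamma>)
      = (Lam \<gamma> * left_share) * (Lam \<gamma> * (1 - left_share)) + (tan \<theta>)\<^sup>2"
    using Lam_positive by (simp add: algebra_simps)
  also have "\<dots> = (tan \<theta>)\<^sup>2 * (cot a * cot b + 1)"
    unfolding x y by (simp add: power2_eq_square algebra_simps)
  also have "\<dots> = (Lam \<gamma> * (1 - left_share) - Lam \<gamma> * left_share) * gap_coeff"
    unfolding c x y gap_coeff_def ab[symmetric] by (simp add: power2_eq_square algebra_simps)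
  also have "\<dots> = Lam \<gamma> * ((1 - 2 * left_share) * gap_coeff)"
    by (simp add: algebra_simps)
  finally show ?thesis using Lam_positive by simp
qed

text \<open>Since (p - q) \<theta> \<le> \<pi> - q \<theta>, monotonicity bounds the cotangent below
  by - cot (q \<theta>). Both bounds vanish when \<open>q\<close> and p - q tend to
  infinity.\<close>

lemma gap_coeff_bounds:
  assumes "q < p"
  shows "- (tan \<theta> / \<theta> / q) \<le> gap_coeff" "gap_coeff \<le> tan \<theta> / \<theta> / real_of_int (p - q)"
proof -
  have "cot (pi - \<theta> * q) \<le> cot (\<theta> * real_of_int (p - q))"
    using angle_gap[OF assms] by (intro cot_antimono) auto
  then have "tan \<theta> * - cot (\<theta> * q) \<le> gap_coeff"
    unfolding gap_coeff_def using tan_angle_pos by (intro mult_left_mono) (auto simp: cot_def)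
  then show "- (tan \<theta> / \<theta> / q) \<le> gap_coeff" using cot_angle_q_le by simp
  have "cot (\<theta> * real_of_int (p - q)) \<le> 1 / (\<theta> * real_of_int (p - q))"
    using angle_gap[OF assms] by (intro cot_le_inverse)
  then have "gap_coeff \<le> tan \<theta> * (1 / (\<theta> * real_of_int (p - q)))"
    unfolding gap_coeff_def using tan_angle_pos by (intro mult_left_mono) auto
  then show "gap_coeff \<le> tan \<theta> / \<theta> / real_of_int (p - q)" by simp
qed

end

text \<open>Stability of the smaller root. Subtracting the two equations gives (y - \<nu>) (L (1 - y
  - \<nu>) + 2 U) = (1 - 2 y) (u - U) - e, where y \<le> 1/2 and \<nu> < 1/2 keep the second factor
  above a positive constant and \<open>l\<close> keeps 1 - 2 y bounded.\<close>

lemma quadratic_root_tendsto: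
  fixes y u e l :: "nat \<Rightarrow> real"
  assumes L: "0 < L" and U: "0 \<le> U" and \<nu>: "\<nu> \<le> 1 / 2" "L * \<nu> * (1 - \<nu>) = (1 - 2 * \<nu>) * U"
    and eq: "\<forall>\<^sub>F j in sequentially. L * y j * (1 - y j) + e j = (1 - 2 * y j) * u j"
    and y: "\<forall>\<^sub>F j in sequentially. y j \<le> 1 / 2" "\<forall>\<^sub>F j in sequentially. l j \<le> y j"
    and lim: "l \<longlonglongrightarrow> 0" "e \<longlonglongrightarrow> 0" "u \<longlonglongrightarrow> U"
  shows "y \<longlonglongrightarrow> \<nu>"
proof -
  define c where "c = L * (1 / 2 - \<nu>)"
  \<comment> \<open>At 1/2 the right side of the limiting equation vanishes while the left side is
    L/4.\<close>
  have "\<nu> \<noteq> 1 / 2"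
  proof
    assume "\<nu> = 1 / 2"
    then have "L * (1 / 2) * (1 - 1 / 2) = (1 - 2 * (1 / 2)) * U"
      using \<nu>(2) by (simp only:)
    then show False using L by simp
  qed
  then have c: "0 < c" using \<nu> L by (simp add: c_def)
  have "(\<lambda>j. ((1 - 2 * l j) * \<bar>u j - U\<bar> + \<bar>e j\<bar>) / c) \<longlonglongrightarrow> ((1 - 2 * 0) * \<bar>U - U\<bar> + \<bar>0\<bar>) / c"
    by (intro tendsto_intros lim) (use c in simp)
  then have "(\<lambda>j. ((1 - 2 * l j) * \<bar>u j - U\<bar> + \<bar>e j\<bar>) / c) \<longlonglongrightarrow> 0" by simp
  moreover have "\<forall>\<^sub>F j in sequentially. norm (y j - \<nu>) \<le> ((1 - 2 * l j) * \<bar>u j - U\<bar> + \<bar>e j\<bar>) / c"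
    using eq y
  proof eventually_elim
    case (elim j)
    have "(y j - \<nu>) * (L * (1 - y j - \<nu>) + 2 * U)
        = (L * y j * (1 - y j) - (1 - 2 * y j) * U) - (L * \<nu> * (1 - \<nu>) - (1 - 2 * \<nu>) * U)"
      by (simp add: algebra_simps)
    also have "\<dots> = (1 - 2 * y j) * (u j - U) - e j"
      using elim \<nu> by (simp add: algebra_simps)
    finally have *: "(y j - \<nu>) * (L * (1 - y j - \<nu>) + 2 * U) = (1 - 2 * y j) * (u j - U) - e j" .
    have "c \<le> L * (1 - y j - \<nu>) + 2 * U"
      unfolding c_def using elim L U by (intro add_increasing2 mult_left_mono) auto
    then have "\<bar>y j - \<nu>\<bar> * c \<le> \<bar>y j - \<nu>\<bar> * \<bar>L * (1 - y j - \<nu>) + 2 * U\<bar>"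
      by (intro mult_left_mono) auto
    also have "\<dots> = \<bar>(1 - 2 * y j) * (u j - U) - e j\<bar>"
      by (simp only: * abs_mult[symmetric])
    also have "\<dots> \<le> \<bar>1 - 2 * y j\<bar> * \<bar>u j - U\<bar> + \<bar>e j\<bar>"
      by (metis abs_triangle_ineq4 abs_mult)
    also have "\<bar>1 - 2 * y j\<bar> * \<bar>u j - U\<bar> \<le> (1 - 2 * l j) * \<bar>u j - U\<bar>"
      using elim by (intro mult_right_mono) auto
    finally show ?case using c by (simp add: field_simps)
  qed
  ultimately have "(\<lambda>j. y j - \<nu>) \<longlonglongrightarrow> 0"
    by (rule Lim_null_comparison[rotated])
  then show ?thesis by (simp add: LIM_zero_iff)
qed

text \<open>The last identity says that 1 - \<mu> solves the limiting quadratic with U = 1/d. With k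
  = \<Lambda> d and s^2 = k^2 + 4 it reduces to k^2 - (s - 2)^2 = 4 (s - 2); the bounds come from 2
  \<le> s \<le> k + 2.\<close>

lemma mu_positive_int:
  assumes \<gamma>: "0 < \<gamma>" "\<gamma> < 1" and d: "0 < d"
  shows "1 / 2 \<le> mu \<gamma> (Fin d)" "mu \<gamma> (Fin d) \<le> 1" "mu \<gamma> (Fin (- d)) = 1 - mu \<gamma> (Fin d)"
    "Lam \<gamma> * (1 - mu \<gamma> (Fin d)) * mu \<gamma> (Fin d) = (2 * mu \<gamma> (Fin d) - 1) * (1 / d)"
proof -
  define k where "k = Lam \<gamma> * d"
  define s where "s = sqrt (k\<^sup>2 + 4)"
  have k: "0 < k" using Lam_pos[OF \<gamma>] d by (simp add: k_def)
  have s2: "s\<^sup>2 = k\<^sup>2 + 4" by (simp add: s_def)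
  have s: "2 \<le> s" unfolding s_def by (rule real_le_rsqrt) simp
  have s_le: "s \<le> k + 2" unfolding s_def
    using k by (intro real_le_lsqrt) (auto simp: power2_eq_square algebra_simps)
  have m: "mu \<gamma> (Fin d) = (s + k - 2) / (2 * k)" "mu \<gamma> (Fin (- d)) = (s - k - 2) / (- 2 * k)"
    using d by (simp_all add: mu_def mu_expr_def s_def k_def power_mult_distrib mult_ac)
  show "1 / 2 \<le> mu \<gamma> (Fin d)" "mu \<gamma> (Fin d) \<le> 1" "mu \<gamma> (Fin (- d)) = 1 - mu \<gamma> (Fin d)"
    unfolding m using k s s_le by (auto simp: field_simps)
  have "k * ((1 - mu \<gamma> (Fin d)) * mu \<gamma> (Fin d)) = (k\<^sup>2 - (s - 2)\<^sup>2) / (4 * k)"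
    unfolding m using k by (simp add: field_simps power2_eq_square)
  also have "\<dots> = (s - 2) / k"
    using k s2 by (simp add: field_simps power2_diff)
  also have "\<dots> = 2 * mu \<gamma> (Fin d) - 1"
    unfolding m using k by (simp add: field_simps)
  finally show "Lam \<gamma> * (1 - mu \<gamma> (Fin d)) * mu \<gamma> (Fin d) = (2 * mu \<gamma> (Fin d) - 1) * (1 / d)"
    using d by (simp add: k_def field_simps)
qed

lemma mu_in_unit_interval:
  assumes "0 < \<gamma>" "\<gamma> < 1"
  shows "mu \<gamma> \<delta> \<in> {0..1}"
proof (cases \<delta>)
  case (Fin d)
  consider "d = 0" | "0 < d" | "0 < - d" by linarith
  then show ?thesis
    using mu_positive_int[OF assms, of d] mu_positive_int[OF assms, of "- d"] mu_endpoints[OF assms]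
    by cases (auto simp: Fin)
qed (simp_all add: mu_endpoints[OF assms])

lemma psi_delta_eq:
  "psi_delta \<gamma> \<delta> n = (if 0 \<le> n then 1 + Lam \<gamma> * n * mu \<gamma> \<delta> else 1 - Lam \<gamma> * n * (1 - mu \<gamma> \<delta>))"
  by (auto simp: psi_delta_def psi_plus_def psi_minus_def algebra_simps)

lemma psi_delta_pos: "0 < \<gamma> \<Longrightarrow> \<gamma> < 1 \<Longrightarrow> 0 < psi_delta \<gamma> \<delta> n"
proof -
  assume \<gamma>: "0 < \<gamma>" "\<gamma> < 1"
  have p: "1 \<le> psi_plus \<gamma> m" for m using Lam_pos[OF \<gamma>] by (simp add: psi_plus_def)
  have "mu \<gamma> \<delta> * 1 + (1 - mu \<gamma> \<delta>) * 1 \<le> psi_delta \<gamma> \<delta> n"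
    unfolding psi_delta_def psi_minus_eq using mu_in_unit_interval[OF \<gamma>, of \<delta>] p
    by (intro add_mono mult_left_mono) auto
  then show ?thesis by simp
qed

text \<open>Convergence in the discrete integers with two points at infinity: a finite limit means
  eventual equality, which is the source of the quantization. \<open>Minf\<close> is phrased by q -
  p so that exchanging \<open>p\<close> and \<open>q\<close> yields \<open>Pinf\<close>.\<close>

definition diff_tendsto :: "(nat \<Rightarrow> int) \<Rightarrow> (nat \<Rightarrow> int) \<Rightarrow> int extended \<Rightarrow> bool" where
  "diff_tendsto p q \<delta> = (case \<delta> of
       Fin d \<Rightarrow> \<forall>\<^sub>F j in sequentially. p j - q j = d
     | Pinf \<Rightarrow> filterlim (\<lambda>j. p j - q j) at_top sequentially
     | Minf \<Rightarrow> filterlim (\<lambda>j. q j - p j) at_top sequentially)"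

section \<open>Convergence along growing intervals\<close>

locale growing_intervals =
  fixes \<gamma> :: real and p q :: "nat \<Rightarrow> int" and \<theta> :: "nat \<Rightarrow> real"
  assumes bnd: "\<And>j. boundary_angle \<gamma> (p j) (q j) (\<theta> j)"
    and p_lim: "filterlim p at_top sequentially" and q_lim: "filterlim q at_top sequentially"
begin

lemma real_p_lim: "filterlim (\<lambda>j. real_of_int (p j)) at_top sequentially"
  by (rule filterlim_compose[OF filterlim_real_of_int_at_top p_lim])

lemma angle_lim: "filterlim \<theta> (at_right 0) sequentially"
proof (rule tendsto_imp_filterlim_at_right)
  show "\<forall>\<^sub>F j in sequentially. 0 < \<theta> j"
    using boundary_angle.angle_pos[OF bnd] by simp
  have "\<theta> j \<le> pi / real_of_int (p j)" for j
    using boundary_angle.angle_p[OF bnd, of j] boundary_angle.pq[OF bnd, of j] by (simp add: field_simps)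
  then have upper: "\<forall>\<^sub>F j in sequentially. \<theta> j \<le> pi / real_of_int (p j)"
    by simp
  have lower: "\<forall>\<^sub>F j in sequentially. 0 \<le> \<theta> j"
    using less_imp_le[OF boundary_angle.angle_pos[OF bnd]] by simp
  show "\<theta> \<longlonglongrightarrow> 0"
    by (rule tendsto_sandwich[OF lower upper tendsto_const])
       (rule real_tendsto_divide_at_top[OF tendsto_const real_p_lim])
qed

lemma small: "\<forall>\<^sub>F j in sequentially. small_boundary_angle \<gamma> (p j) (q j) (\<theta> j)"
proof -
  have "\<forall>\<^sub>F t in at_right 0. t < pi / 2"
    by (rule eventually_at_rightI[of 0 "pi / 2"]) auto
  then have "\<forall>\<^sub>F j in sequentially. \<theta> j < pi / 2"
    using angle_lim by (auto simp: filterlim_iff)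
  then show ?thesis
    by eventually_elim (simp add: small_boundary_angle_def small_boundary_angle_axioms_def bnd)
qed

abbreviation share :: "nat \<Rightarrow> real" where
  "share j \<equiv> small_boundary_angle.left_share \<gamma> (q j) (\<theta> j)"

text \<open>Once \<open>n\<close> lies between the ends, the eigenfunction at \<open>n\<close>
  depends on the interval only through \<theta> and the share, so one real sequence governs all
  pointwise limits.\<close>

lemma psi_pq_tendsto_of_share:
  assumes "share \<longlonglongrightarrow> 1 - mu \<gamma> \<delta>"
  shows "(\<lambda>j. psi_pq \<gamma> (p j) (q j) n) \<longlonglongrightarrow> psi_delta \<gamma> \<delta> n"
proof -
  have cos_lim: "(\<lambda>j. cos (\<theta> j * real_of_int m)) \<longlonglongrightarrow> 1" for m
  proof -
    have "((\<lambda>t. cos (t * real_of_int m)) \<longlongrightarrow> 1) (at_right 0)" by real_asymp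
    then show ?thesis using angle_lim by (rule filterlim_compose)
  qed
  have sin_lim: "(\<lambda>j. sin (\<theta> j * real_of_int m) / tan (\<theta> j)) \<longlonglongrightarrow> real_of_int m" for m
  proof -
    have "((\<lambda>t. sin (t * real_of_int m) / tan t) \<longlongrightarrow> real_of_int m) (at_right 0)" by real_asymp
    then show ?thesis using angle_lim by (rule filterlim_compose)
  qed
  show ?thesis
  proof (cases "0 \<le> n")
    case True
    have "(\<lambda>j. cos (\<theta> j * n) + sin (\<theta> j * n) / tan (\<theta> j) * (Lam \<gamma> * (1 - share j)))
        \<longlonglongrightarrow> 1 + n * (Lam \<gamma> * (1 - (1 - mu \<gamma> \<delta>)))"
      by (intro tendsto_intros cos_lim sin_lim assms)
    moreover have "1 + n * (Lam \<gamma> * (1 - (1 - mu \<gamma> \<delta>))) = psi_delta \<gamma> \<delta> n"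
      using True by (simp add: psi_delta_eq algebra_simps)
    moreover have "\<forall>\<^sub>F j in sequentially. cos (\<theta> j * n) + sin (\<theta> j * n) / tan (\<theta> j) * (Lam \<gamma> * (1 - share j))
        = psi_pq \<gamma> (p j) (q j) n"
      using small eventually_compose_filterlim[OF eventually_ge_at_top[of n] p_lim]
    proof eventually_elim
      case (elim j)
      interpret small_boundary_angle \<gamma> "p j" "q j" "\<theta> j" by (rule elim)
      show ?case using True elim by (simp add: psi_pq_eq glued_sine_def ray_sine_right)
    qed
    ultimately show ?thesis using tendsto_cong by force
  next
    case False
    define m where "m = - n"
    have "(\<lambda>j. cos (\<theta> j * m) + sin (\<theta> j * m) / tan (\<theta> j) * (Lam \<gamma> * share j))
        \<longlonglongrightarrow> 1 + m * (Lam \<gamma> * (1 - mu \<gamma> \<delta>))"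
      by (intro tendsto_intros cos_lim sin_lim assms)
    moreover have "1 + m * (Lam \<gamma> * (1 - mu \<gamma> \<delta>)) = psi_delta \<gamma> \<delta> n"
      using False by (simp add: psi_delta_eq m_def algebra_simps)
    moreover have "\<forall>\<^sub>F j in sequentially. cos (\<theta> j * m) + sin (\<theta> j * m) / tan (\<theta> j) * (Lam \<gamma> * share j)
        = psi_pq \<gamma> (p j) (q j) n"
      using small eventually_compose_filterlim[OF eventually_ge_at_top[of m] q_lim]
    proof eventually_elim
      case (elim j)
      interpret small_boundary_angle \<gamma> "p j" "q j" "\<theta> j" by (rule elim)
      have "psi_pq \<gamma> (p j) (q j) n = ray_sine (q j) (\<theta> j) m"
        using False by (simp add: psi_pq_eq glued_sine_def m_def)
      then show ?case using elim by (simp add: ray_sine_left)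
    qed
    ultimately show ?thesis using tendsto_cong by force
  qed
qed

lemma tan_ratio_lim: "(\<lambda>j. tan (\<theta> j) / \<theta> j) \<longlonglongrightarrow> 1"
proof -
  have "((\<lambda>t::real. tan t / t) \<longlongrightarrow> 1) (at_right 0)" by real_asymp
  then show ?thesis using angle_lim by (rule filterlim_compose)
qed

lemma tan_ratio_div_lim:
  assumes "filterlim r at_top sequentially"
  shows "(\<lambda>j. tan (\<theta> j) / \<theta> j / real_of_int (r j)) \<longlonglongrightarrow> 0"
  by (rule real_tendsto_divide_at_top[OF tan_ratio_lim])
     (rule filterlim_compose[OF filterlim_real_of_int_at_top assms])

text \<open>Applies \<open>quadratic_root_tendsto\<close> with the share as y,
  \<open>gap_coeff\<close> as u, tan^2 \<theta> / \<Lambda> as the vanishing error and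
  \<open>left_share_ge\<close> as lower bound.\<close>

lemma share_tendsto_of_gap:
  assumes gap: "\<forall>\<^sub>F j in sequentially. q j < p j"
    and lim: "(\<lambda>j. small_boundary_angle.gap_coeff (p j) (q j) (\<theta> j)) \<longlonglongrightarrow> U"
    and U: "0 \<le> U" "\<nu> \<le> 1 / 2" "Lam \<gamma> * \<nu> * (1 - \<nu>) = (1 - 2 * \<nu>) * U"
  shows "share \<longlonglongrightarrow> \<nu>"
proof (rule quadratic_root_tendsto[OF _ U])
  show "0 < Lam \<gamma>" using boundary_angle.\<gamma>[OF bnd] by (rule Lam_pos)
  show "\<forall>\<^sub>F j in sequentially. Lam \<gamma> * share j * (1 - share j) + (tan (\<theta> j))\<^sup>2 / Lam \<gamma>
      = (1 - 2 * share j) * small_boundary_angle.gap_coeff (p j) (q j) (\<theta> j)"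
    using small gap by eventually_elim (rule small_boundary_angle.left_share_quadratic)
  show "\<forall>\<^sub>F j in sequentially. share j \<le> 1 / 2"
    using small gap by eventually_elim (erule small_boundary_angle.left_share_le, erule less_imp_le)
  show "\<forall>\<^sub>F j in sequentially. - (tan (\<theta> j) / \<theta> j / q j) / Lam \<gamma> \<le> share j"
    using small by eventually_elim (rule small_boundary_angle.left_share_ge)
  have "(\<lambda>j. - (tan (\<theta> j) / \<theta> j / q j) / Lam \<gamma>) \<longlonglongrightarrow> - 0 / Lam \<gamma>"
    using \<open>0 < Lam \<gamma>\<close> by (intro tendsto_intros tan_ratio_div_lim q_lim) simp
  then show "(\<lambda>j. - (tan (\<theta> j) / \<theta> j / q j) / Lam \<gamma>) \<longlonglongrightarrow> 0" by simp
  have "((\<lambda>t. (tan t)\<^sup>2 / Lam \<gamma>) \<longlongrightarrow> 0) (at_right 0)"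
    using \<open>0 < Lam \<gamma>\<close> by real_asymp
  then show "(\<lambda>j. (tan (\<theta> j))\<^sup>2 / Lam \<gamma>) \<longlonglongrightarrow> 0"
    using angle_lim by (rule filterlim_compose)
  show "(\<lambda>j. small_boundary_angle.gap_coeff (p j) (q j) (\<theta> j)) \<longlonglongrightarrow> U" by (rule lim)
qed

lemma share_tendsto_nonneg:
  assumes "diff_tendsto p q \<delta>" "\<delta> = Pinf \<or> (\<exists>d\<ge>0. \<delta> = Fin d)"
  shows "share \<longlonglongrightarrow> 1 - mu \<gamma> \<delta>"
proof -
  note \<gamma> = boundary_angle.\<gamma>[OF bnd]
  consider "\<delta> = Pinf" | "\<delta> = Fin 0" | d where "\<delta> = Fin d" "0 < d"
    using assms(2) by force
  then show ?thesis
  proof cases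
    case 1
    have gap: "filterlim (\<lambda>j. p j - q j) at_top sequentially"
      using assms(1) by (simp add: diff_tendsto_def 1)
    have lt: "\<forall>\<^sub>F j in sequentially. q j < p j"
      using eventually_compose_filterlim[OF eventually_gt_at_top[of 0] gap] by simp
    have "(\<lambda>j. small_boundary_angle.gap_coeff (p j) (q j) (\<theta> j)) \<longlonglongrightarrow> 0"
    proof (rule tendsto_sandwich)
      show "\<forall>\<^sub>F j in sequentially. - (tan (\<theta> j) / \<theta> j / q j) \<le> small_boundary_angle.gap_coeff (p j) (q j) (\<theta> j)"
        using small lt by eventually_elim (rule small_boundary_angle.gap_coeff_bounds)
      show "\<forall>\<^sub>F j in sequentially. small_boundary_angle.gap_coeff (p j) (q j) (\<theta> j)
          \<le> tan (\<theta> j) / \<theta> j / real_of_int (p j - q j)"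
        using small lt by eventually_elim (rule small_boundary_angle.gap_coeff_bounds)
      show "(\<lambda>j. - (tan (\<theta> j) / \<theta> j / q j)) \<longlonglongrightarrow> 0"
        using tendsto_minus[OF tan_ratio_div_lim[OF q_lim]] by simp
      show "(\<lambda>j. tan (\<theta> j) / \<theta> j / real_of_int (p j - q j)) \<longlonglongrightarrow> 0"
        by (rule tan_ratio_div_lim[OF gap])
    qed
    then have "share \<longlonglongrightarrow> 0"
      by (rule share_tendsto_of_gap[OF lt]) auto
    then show ?thesis by (simp add: 1 mu_endpoints[OF \<gamma>])
  next
    case 2
    \<comment> \<open>For p = q the subtraction formula degenerates, but the two shares coincide and
      sum to 1.\<close>
    have "\<forall>\<^sub>F j in sequentially. p j - q j = 0"
      using assms(1) by (simp add: diff_tendsto_def 2)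
    then have "\<forall>\<^sub>F j in sequentially. share j = 1 / 2"
      using small
    proof eventually_elim
      case (elim j)
      interpret small_boundary_angle \<gamma> "p j" "q j" "\<theta> j" by (rule elim)
      have "p j = q j" using elim by simp
      then have "1 - left_share = left_share"
        by (simp only: one_minus_left_share) (simp only: left_share_def)
      then show ?case by simp
    qed
    then show ?thesis
      by (simp add: 2 mu_endpoints[OF \<gamma>] tendsto_eventually)
  next
    case 3
    have d: "\<forall>\<^sub>F j in sequentially. p j - q j = d"
      using assms(1) by (simp add: diff_tendsto_def 3)
    have lt: "\<forall>\<^sub>F j in sequentially. q j < p j"
      using d by eventually_elim (use 3 in auto)
    \<comment> \<open>With the difference frozen at \<open>d\<close>, the limit of the gap
      coefficient is 1/d, the value U in the quadratic solved by 1 - \<mu>.\<close>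
    have "((\<lambda>t. tan t * cot (t * real_of_int d)) \<longlongrightarrow> inverse (real_of_int d)) (at_right 0)"
      using 3 unfolding cot_def by real_asymp
    then have "(\<lambda>j. tan (\<theta> j) * cot (\<theta> j * real_of_int d)) \<longlonglongrightarrow> 1 / d"
      unfolding inverse_eq_divide using angle_lim by (rule filterlim_compose)
    moreover have "\<forall>\<^sub>F j in sequentially. tan (\<theta> j) * cot (\<theta> j * real_of_int d)
        = small_boundary_angle.gap_coeff (p j) (q j) (\<theta> j)"
      using small d
    proof eventually_elim
      case (elim j)
      interpret small_boundary_angle \<gamma> "p j" "q j" "\<theta> j" by (rule elim)
      show ?case using elim by (simp add: gap_coeff_def)
    qed
    ultimately have "(\<lambda>j. small_boundary_angle.gap_coeff (p j) (q j) (\<theta> j)) \<longlonglongrightarrow> 1 / d"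
      using tendsto_cong by force
    then show ?thesis
      by (rule share_tendsto_of_gap[OF lt])
         (use 3 mu_positive_int[OF \<gamma> \<open>0 < d\<close>] in \<open>auto simp: algebra_simps\<close>)
  qed
qed

lemma spectral_radius_tendsto:
  "(\<lambda>j. comb_spectral_radius (H (p j) (q j)) (adjacency \<gamma>)) \<longlonglongrightarrow> 2"
proof -
  have "((\<lambda>t. 2 * cos t) \<longlongrightarrow> (2::real)) (at_right 0)" by real_asymp
  then have "(\<lambda>j. 2 * cos (\<theta> j)) \<longlonglongrightarrow> 2" using angle_lim by (rule filterlim_compose)
  then show ?thesis by (simp add: boundary_angle.spectral_radius_H[OF bnd])
qed

end

section \<open>Limit points\<close>

lemma growing_intervals_exists:
  assumes \<gamma>: "0 < \<gamma>" "\<gamma> < 1" and pq: "\<And>j. 1 \<le> p j" "\<And>j. 1 \<le> q j"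
    and lim: "filterlim p at_top sequentially" "filterlim q at_top sequentially"
  shows "\<exists>\<theta>. growing_intervals \<gamma> p q \<theta>"
proof -
  have "\<forall>j. \<exists>t. principal_angle \<gamma> (p j) (q j) t"
    using principal_angle_exists[OF \<gamma>] pq by blast
  then obtain \<theta> where "\<And>j. principal_angle \<gamma> (p j) (q j) (\<theta> j)" by metis
  then show ?thesis
    using assms by (intro exI[of _ \<theta>]) (simp add: growing_intervals_def boundary_angle_def)
qed

text \<open>The principal angle is symmetric in \<open>p\<close> and \<open>q\<close>, so the
  eigenfunctions are mirror images. At 0 the branches need the common value 1.\<close>

lemma psi_pq_swap:
  assumes \<gamma>: "0 < \<gamma>" "\<gamma> < 1" and pq: "1 \<le> p" "1 \<le> q"
  shows "psi_pq \<gamma> q p n = psi_pq \<gamma> p q (- n)"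
proof -
  obtain \<theta> where \<theta>: "principal_angle \<gamma> p q \<theta>"
    using principal_angle_exists assms by blast
  interpret a: boundary_angle \<gamma> p q \<theta> by unfold_locales (use assms \<theta> in auto)
  interpret b: boundary_angle \<gamma> q p \<theta>
    by unfold_locales (use assms \<theta> principal_angle_commute in auto)
  have "ray_sine p \<theta> 0 = 1" "ray_sine q \<theta> 0 = 1"
    using pq a.sin_angle_pos by (auto simp: ray_sine_0)
  then show ?thesis
    by (cases "n = 0") (auto simp: a.psi_pq_eq b.psi_pq_eq glued_sine_def)
qed

lemma psi_delta_reflect:
  "mu \<gamma> \<delta>' = 1 - mu \<gamma> \<delta> \<Longrightarrow> psi_delta \<gamma> \<delta>' (- n) = psi_delta \<gamma> \<delta> n"
  by (simp add: psi_delta_def psi_minus_eq)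

lemma psi_pq_tendsto:
  assumes \<gamma>: "0 < \<gamma>" "\<gamma> < 1" and pq: "\<And>j. 1 \<le> p j" "\<And>j. 1 \<le> q j"
    and lim: "filterlim p at_top sequentially" "filterlim q at_top sequentially"
    and diff: "diff_tendsto p q \<delta>"
  shows "(\<lambda>j. psi_pq \<gamma> (p j) (q j) n) \<longlonglongrightarrow> psi_delta \<gamma> \<delta> n"
proof -
  have nonneg: "(\<lambda>j. psi_pq \<gamma> (p' j) (q' j) m) \<longlonglongrightarrow> psi_delta \<gamma> \<delta>' m"
    if pq': "\<And>j. 1 \<le> p' j" "\<And>j. 1 \<le> q' j"
      "filterlim p' at_top sequentially" "filterlim q' at_top sequentially"
      and "diff_tendsto p' q' \<delta>'" "\<delta>' = Pinf \<or> (\<exists>d\<ge>0. \<delta>' = Fin d)"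
    for p' q' :: "nat \<Rightarrow> int" and \<delta>' m
  proof -
    obtain \<theta> where "growing_intervals \<gamma> p' q' \<theta>"
      using growing_intervals_exists[OF \<gamma>] pq' by blast
    then interpret growing_intervals \<gamma> p' q' \<theta> .
    show ?thesis
      by (intro psi_pq_tendsto_of_share share_tendsto_nonneg that)
  qed
  \<comment> \<open>Negative differences are reduced to positive ones by mirroring the line, which
    replaces \<mu> by 1 - \<mu>.\<close>
  have reflected: ?thesis
    if "diff_tendsto q p \<delta>'" "\<delta>' = Pinf \<or> (\<exists>d\<ge>0. \<delta>' = Fin d)" "mu \<gamma> \<delta>' = 1 - mu \<gamma> \<delta>" for \<delta>'
    using nonneg[of q p \<delta>' "- n"] that pq lim
    by (simp add: psi_pq_swap[OF \<gamma> pq] psi_delta_reflect)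
  show ?thesis
  proof (cases \<delta>)
    case (Fin d)
    show ?thesis
    proof (cases "0 \<le> d")
      case True
      then show ?thesis using nonneg[of p q \<delta> n] pq lim diff Fin by blast
    next
      case False
      have "diff_tendsto q p (Fin (- d))"
        using diff unfolding Fin diff_tendsto_def extended.case
        by (auto elim: eventually_mono)
      moreover have "mu \<gamma> (Fin (- d)) = 1 - mu \<gamma> \<delta>"
        using mu_positive_int(3)[OF \<gamma>, of "- d"] False by (simp add: Fin)
      ultimately show ?thesis
        using False by (intro reflected[of "Fin (- d)"]) auto
    qed
  next
    case Pinf
    then show ?thesis using nonneg[of p q \<delta> n] pq lim diff by blast
  next
    case Minf
    have "diff_tendsto q p Pinf"
      using diff by (simp add: diff_tendsto_def Minf)
    then show ?thesis
      by (rule reflected) (simp_all add: Minf mu_endpoints[OF \<gamma>])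
  qed
qed

text \<open>Compactness of the extended reals gives a subsequence of p - q with a limit; convergent
  integers are eventually constant.\<close>

lemma diff_tendsto_subsequence:
  fixes p q :: "nat \<Rightarrow> int"
  shows "\<exists>\<delta> r. strict_mono r \<and> diff_tendsto (p \<circ> r) (q \<circ> r) \<delta>"
proof -
  obtain l r where r: "strict_mono r"
    and l: "((\<lambda>j. ereal (real_of_int (p j - q j))) \<circ> r) \<longlonglongrightarrow> l"
    using compact_complete_linorder by blast
  define v where "v j = p (r j) - q (r j)" for j
  have v: "(\<lambda>j. ereal (real_of_int (v j))) \<longlonglongrightarrow> l"
    using l by (simp add: v_def comp_def)
  have int_at_top: "filterlim w at_top sequentially"
    if "filterlim (\<lambda>j. real_of_int (w j)) at_top sequentially" for w :: "nat \<Rightarrow> int"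
    unfolding filterlim_at_top
  proof
    fix Z :: int
    have "\<forall>\<^sub>F j in sequentially. real_of_int Z \<le> real_of_int (w j)"
      using that unfolding filterlim_at_top by (rule spec)
    then show "\<forall>\<^sub>F j in sequentially. Z \<le> w j" by simp
  qed
  have "\<exists>\<delta>. diff_tendsto (p \<circ> r) (q \<circ> r) \<delta>"
  proof (cases l)
    case (real x)
    then have "(\<lambda>j. real_of_int (v j)) \<longlonglongrightarrow> x" using v by simp
    \<comment> \<open>Two integers within 1/2 of \<open>x\<close> differ by less than 1 and hence
      agree.\<close>
    then have "\<forall>\<^sub>F j in sequentially. dist (real_of_int (v j)) x < 1 / 2"
      by (rule tendstoD) simp
    then obtain N where N: "\<And>j. j \<ge> N \<Longrightarrow> \<bar>real_of_int (v j) - x\<bar> < 1 / 2"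
      by (auto simp: eventually_sequentially dist_real_def)
    have "v j = v N" if "j \<ge> N" for j
    proof -
      have "\<bar>real_of_int (v j) - real_of_int (v N)\<bar> < 1"
        using N[OF that] N[of N] by linarith
      then show ?thesis by linarith
    qed
    then have "diff_tendsto (p \<circ> r) (q \<circ> r) (Fin (v N))"
      unfolding diff_tendsto_def extended.case eventually_sequentially comp_def v_def[symmetric]
      by blast
    then show ?thesis ..
  next
    case PInf
    then have "filterlim (\<lambda>j. real_of_int (v j)) at_top sequentially"
      using v by (simp add: tendsto_PInfty_eq_at_top)
    then have "diff_tendsto (p \<circ> r) (q \<circ> r) Pinf"
      using int_at_top by (simp add: diff_tendsto_def v_def)
    then show ?thesis ..
  next
    case MInf
    then have "(\<lambda>j. - ereal (real_of_int (v j))) \<longlonglongrightarrow> - (- \<infinity>)"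
      using v by (intro tendsto_uminus_ereal) simp
    then have "filterlim (\<lambda>j. real_of_int (- v j)) at_top sequentially"
      by (simp add: tendsto_PInfty_eq_at_top[symmetric])
    then have "filterlim (\<lambda>j. - v j) at_top sequentially"
      by (rule int_at_top)
    then have "diff_tendsto (p \<circ> r) (q \<circ> r) Minf"
      by (simp add: diff_tendsto_def v_def)
    then show ?thesis ..
  qed
  then show ?thesis using r by blast
qed

text \<open>The bound 2 excludes the one-vertex interval, whose spectral radius 0 admits no
  MERW.\<close>

lemma diff_tendsto_exists:
  "\<exists>p q. (\<forall>j. 2 \<le> p j \<and> 2 \<le> q j) \<and> filterlim p at_top sequentially \<and>
     filterlim q at_top sequentially \<and> diff_tendsto p q \<delta>"
proof -
  have top: "filterlim f at_top sequentially" if "\<And>j. int j \<le> f j" for f :: "nat \<Rightarrow> int"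
    by (rule filterlim_at_top_mono[OF filterlim_int_sequentially]) (simp add: that)
  show ?thesis
  proof (cases \<delta>)
    case (Fin d)
    show ?thesis
      \<comment> \<open>Positive and negative part of \<open>d\<close> are added to opposite ends,
        so both sequences grow and their difference is \<open>d\<close>.\<close>
      by (intro exI[of _ "\<lambda>j. int j + 2 + max d 0"] exI[of _ "\<lambda>j. int j + 2 + max (- d) 0"])
         (auto simp: diff_tendsto_def Fin intro!: top)
  next
    case Pinf
    show ?thesis
      by (intro exI[of _ "\<lambda>j. 2 * int j + 2"] exI[of _ "\<lambda>j. int j + 2"])
         (auto simp: diff_tendsto_def Pinf intro!: top)
  next
    case Minf
    show ?thesis
      by (intro exI[of _ "\<lambda>j. int j + 2"] exI[of _ "\<lambda>j. 2 * int j + 2"])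
         (auto simp: diff_tendsto_def Minf intro!: top)
  qed
qed

lemma limit_points_psi_pq:
  assumes \<gamma>: "0 < \<gamma>" "\<gamma> < 1"
  shows "limit_points_pq (psi_pq \<gamma>) = {psi_delta \<gamma> \<delta> | \<delta>. True}"
proof (intro equalityI subsetI)
  fix \<psi> assume "\<psi> \<in> limit_points_pq (psi_pq \<gamma>)"
  then obtain p q where pq: "\<And>j. 1 \<le> p j" "\<And>j. 1 \<le> q j"
    and top: "filterlim p at_top sequentially" "filterlim q at_top sequentially"
    and lim: "\<And>n. (\<lambda>j. psi_pq \<gamma> (p j) (q j) n) \<longlonglongrightarrow> \<psi> n"
    by (auto simp: limit_points_pq_def)
  \<comment> \<open>Passing to the subsequence keeps the limit, which is therefore one of the
    classified functions.\<close>
  obtain \<delta> r where r: "strict_mono r" and \<delta>: "diff_tendsto (p \<circ> r) (q \<circ> r) \<delta>"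
    using diff_tendsto_subsequence by blast
  have "\<psi> n = psi_delta \<gamma> \<delta> n" for n
  proof (rule LIMSEQ_unique)
    show "(\<lambda>j. psi_pq \<gamma> ((p \<circ> r) j) ((q \<circ> r) j) n) \<longlonglongrightarrow> \<psi> n"
      using LIMSEQ_subseq_LIMSEQ[OF lim r] by (simp add: comp_def)
    show "(\<lambda>j. psi_pq \<gamma> ((p \<circ> r) j) ((q \<circ> r) j) n) \<longlonglongrightarrow> psi_delta \<gamma> \<delta> n"
      using pq filterlim_compose[OF _ filterlim_subseq[OF r]] top
      by (intro psi_pq_tendsto \<gamma> \<delta>) (auto simp: comp_def)
  qed
  then show "\<psi> \<in> {psi_delta \<gamma> \<delta> | \<delta>. True}" by auto
next
  fix \<psi> assume "\<psi> \<in> {psi_delta \<gamma> \<delta> | \<delta>. True}"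
  then obtain \<delta> where \<psi>: "\<psi> = psi_delta \<gamma> \<delta>" by blast
  obtain p q where pq: "\<And>j. 2 \<le> p j" "\<And>j. 2 \<le> q j"
    and top: "filterlim p at_top sequentially" "filterlim q at_top sequentially"
    and \<delta>: "diff_tendsto p q \<delta>"
    using diff_tendsto_exists[of \<delta>] by blast
  have pq1: "1 \<le> p j" "1 \<le> q j" for j
    using pq[of j] by simp_all
  show "\<psi> \<in> limit_points_pq (psi_pq \<gamma>)"
    unfolding limit_points_pq_def \<psi> using pq1 top psi_pq_tendsto[OF \<gamma> pq1 top \<delta>] by blast
qed

section \<open>Maximal entropy random walks and their limits\<close>

lemma is_merw_merw_kernel:
  assumes \<gamma>: "0 < \<gamma>" and \<psi>: "\<And>x. x \<in> V \<Longrightarrow> 0 < \<psi> x" "rho_eigenfunction V (adjacency \<gamma>) \<psi>"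
    and \<rho>: "0 < comb_spectral_radius V (adjacency \<gamma>)"
  shows "is_merw V (adjacency \<gamma>) (merw_kernel V (adjacency \<gamma>) \<psi>)"
proof -
  let ?\<rho> = "comb_spectral_radius V (adjacency \<gamma>)"
  have "((\<lambda>y. merw_kernel V (adjacency \<gamma>) \<psi> x y) has_sum 1) V" if "x \<in> V" for x
  proof -
    \<comment> \<open>Row sums equal 1 because this is the eigenvalue equation divided by \<rho>
      \<psi>(x).\<close>
    have "((\<lambda>y. adjacency \<gamma> x y * \<psi> y * inverse (?\<rho> * \<psi> x)) has_sum (?\<rho> * \<psi> x * inverse (?\<rho> * \<psi> x))) V"
      using \<psi>(2) that by (intro has_sum_cmult_left) (simp add: rho_eigenfunction_def)
    moreover have "?\<rho> * \<psi> x * inverse (?\<rho> * \<psi> x) = 1"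
      by (rule right_inverse) (use \<rho> \<psi>(1)[OF that] in simp)
    ultimately show ?thesis by (simp add: merw_kernel_def divide_inverse mult.assoc)
  qed
  moreover have "0 \<le> merw_kernel V (adjacency \<gamma>) \<psi> x y" if "x \<in> V" "y \<in> V" for x y
    using \<psi>(1) \<rho> \<gamma> that
    by (auto simp: merw_kernel_def adjacency_def intro!: mult_nonneg_nonneg divide_nonneg_nonneg less_imp_le)
  ultimately show ?thesis
    using \<psi> unfolding is_merw_def markov_kernel_on_def by blast
qed

text \<open>The kernel is unchanged under scaling of \<psi>. Normalizing at 0 and extending by zero
  gives a function satisfying \<open>is_psi_pq\<close>, which is unique.\<close>

lemma is_merw_H_unique:
  assumes \<gamma>: "0 < \<gamma>" "\<gamma> < 1" and pq: "1 \<le> p" "1 \<le> q"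
    and Q: "is_merw (H p q) (adjacency \<gamma>) Q" and xy: "x \<in> H p q" "y \<in> H p q"
  shows "Q x y = merw_kernel (H p q) (adjacency \<gamma>) (psi_pq \<gamma> p q) x y"
proof -
  obtain \<theta> where "principal_angle \<gamma> p q \<theta>"
    using principal_angle_exists assms by blast
  then interpret boundary_angle \<gamma> p q \<theta> by unfold_locales (use assms in auto)
  obtain \<psi> where \<psi>: "\<And>x. x \<in> H p q \<Longrightarrow> 0 < \<psi> x"
    and eig: "rho_eigenfunction (H p q) (adjacency \<gamma>) \<psi>"
    and Q\<psi>: "Q x y = merw_kernel (H p q) (adjacency \<gamma>) \<psi> x y"
    using Q xy by (auto simp: is_merw_def)
  have "0 \<in> H p q" using pq by (simp add: H_def)
  then have \<psi>0: "0 < \<psi> 0" by (rule \<psi>)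
  define \<phi> where "\<phi> n = (if n \<in> H p q then \<psi> n / \<psi> 0 else 0)" for n
  have "vertex_weight \<gamma> z * nbr_sum (H p q) \<phi> z = comb_spectral_radius (H p q) (adjacency \<gamma>) * \<phi> z"
    if "z \<in> H p q" for z
  proof -
    have "nbr_sum (H p q) \<phi> z = nbr_sum (H p q) (\<lambda>n. \<psi> n * inverse (\<psi> 0)) z"
      by (rule nbr_sum_cong) (simp add: \<phi>_def divide_inverse)
    also have "\<dots> = nbr_sum (H p q) \<psi> z / \<psi> 0"
      by (simp add: nbr_sum_mult_right[symmetric] divide_inverse)
    finally show ?thesis
      using eig that unfolding rho_eigenfunction_adjacency_iff by (simp add: \<phi>_def)
  qed
  then have "is_psi_pq \<gamma> p q \<phi>"
    using \<psi>0 \<open>0 \<in> H p q\<close> by (simp add: is_psi_pq_def rho_eigenfunction_adjacency_iff) (simp add: \<phi>_def)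
  then have "psi_pq \<gamma> p q = \<phi>"
    by (simp add: is_psi_pq_iff psi_pq_eq)
  then show ?thesis
    using xy \<psi>0 by (simp add: Q\<psi> merw_kernel_def \<phi>_def)
qed

lemma eventually_mem_H:
  assumes "filterlim p at_top sequentially" "filterlim q at_top sequentially"
  shows "\<forall>\<^sub>F j in sequentially. x \<in> H (p j) (q j)"
  using eventually_compose_filterlim[OF eventually_gt_at_top[of x] assms(1)]
    eventually_compose_filterlim[OF eventually_gt_at_top[of "- x"] assms(2)]
  by eventually_elim (simp add: H_def)

lemma merw_kernel_tendsto:
  assumes \<gamma>: "0 < \<gamma>" "\<gamma> < 1" and pq: "\<And>j. 1 \<le> p j" "\<And>j. 1 \<le> q j"
    and lim: "filterlim p at_top sequentially" "filterlim q at_top sequentially"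
    and diff: "diff_tendsto p q \<delta>"
  shows "(\<lambda>j. merw_kernel (H (p j) (q j)) (adjacency \<gamma>) (psi_pq \<gamma> (p j) (q j)) x y)
           \<longlonglongrightarrow> merw_kernel UNIV (adjacency \<gamma>) (psi_delta \<gamma> \<delta>) x y"
proof -
  obtain \<theta> where "growing_intervals \<gamma> p q \<theta>"
    using growing_intervals_exists[OF \<gamma>] pq lim by blast
  then interpret growing_intervals \<gamma> p q \<theta> .
  have "psi_delta \<gamma> \<delta> x \<noteq> 0" using psi_delta_pos[OF \<gamma>, of \<delta> x] by simp
  then show ?thesis
    unfolding merw_kernel_def spectral_radius_UNIV[OF \<gamma>]
    by (intro tendsto_intros spectral_radius_tendsto psi_pq_tendsto assms) auto
qed

lemma is_merw_psi_delta:
  assumes \<gamma>: "0 < \<gamma>" "\<gamma> < 1"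
  shows "is_merw UNIV (adjacency \<gamma>) (merw_kernel UNIV (adjacency \<gamma>) (psi_delta \<gamma> \<delta>))"
proof (rule is_merw_merw_kernel)
  show "rho_eigenfunction UNIV (adjacency \<gamma>) (psi_delta \<gamma> \<delta>)"
    unfolding rho_eigenfunction_adjacency_iff spectral_radius_UNIV[OF \<gamma>] nbr_sum_UNIV
  proof
    fix x
    have "vertex_weight \<gamma> x * (psi_delta \<gamma> \<delta> (x - 1) + psi_delta \<gamma> \<delta> (x + 1))
        = mu \<gamma> \<delta> * (vertex_weight \<gamma> x * (psi_plus \<gamma> (x - 1) + psi_plus \<gamma> (x + 1)))
          + (1 - mu \<gamma> \<delta>) * (vertex_weight \<gamma> x * (psi_minus \<gamma> (x - 1) + psi_minus \<gamma> (x + 1)))"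
      unfolding psi_delta_def by (simp add: algebra_simps)
    also have "\<dots> = 2 * psi_delta \<gamma> \<delta> x"
      unfolding psi_plus_eigen[OF \<gamma>] psi_minus_eigen[OF \<gamma>] psi_delta_def by (simp add: algebra_simps)
    finally show "vertex_weight \<gamma> x * (psi_delta \<gamma> \<delta> (x - 1) + psi_delta \<gamma> \<delta> (x + 1)) = 2 * psi_delta \<gamma> \<delta> x" .
  qed
qed (use \<gamma> psi_delta_pos spectral_radius_UNIV in auto)

text \<open>With 2 \<le> p the angle stays below \<pi>/2, so the spectral radius 2 cos \<theta> is
  positive and may be divided by.\<close>

lemma is_merw_H:
  assumes \<gamma>: "0 < \<gamma>" "\<gamma> < 1" and two: "2 \<le> p" and q: "1 \<le> q"
  shows "is_merw (H p q) (adjacency \<gamma>) (merw_kernel (H p q) (adjacency \<gamma>) (psi_pq \<gamma> p q))"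
proof -
  obtain \<theta> where "principal_angle \<gamma> p q \<theta>"
    using principal_angle_exists[of \<gamma> p q] assms by auto
  then interpret boundary_angle \<gamma> p q \<theta> by unfold_locales (use assms in auto)
  have "\<theta> * 2 \<le> \<theta> * p" using angle_pos two by simp
  then have "0 < cos \<theta>" using angle_pos angle_p by (intro cos_gt_zero) linarith+
  moreover have "is_psi_pq \<gamma> p q (glued_sine p q \<theta>)"
    by (simp add: is_psi_pq_iff)
  ultimately show ?thesis
    unfolding psi_pq_eq
    by (intro is_merw_merw_kernel) (auto simp: spectral_radius_H \<gamma> is_psi_pq_def glued_sine_pos)
qed

lemma merw_limits_adjacency:
  assumes \<gamma>: "0 < \<gamma>" "\<gamma> < 1"
  shows "merw_limits (adjacency \<gamma>) = {merw_kernel UNIV (adjacency \<gamma>) (psi_delta \<gamma> \<delta>) | \<delta>. True}"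
proof (intro equalityI subsetI)
  fix P assume "P \<in> merw_limits (adjacency \<gamma>)"
  then obtain p q Q where pq: "\<And>j. 1 \<le> p j" "\<And>j. 1 \<le> q j"
    and top: "filterlim p at_top sequentially" "filterlim q at_top sequentially"
    and Q: "\<And>j. is_merw (H (p j) (q j)) (adjacency \<gamma>) (Q j)"
    and lim: "\<And>x y. (\<lambda>j. Q j x y) \<longlonglongrightarrow> P x y"
    by (auto simp: merw_limits_def)
  obtain \<delta> r where r: "strict_mono r" and \<delta>: "diff_tendsto (p \<circ> r) (q \<circ> r) \<delta>"
    using diff_tendsto_subsequence by blast
  have top': "filterlim (p \<circ> r) at_top sequentially" "filterlim (q \<circ> r) at_top sequentially"
    using filterlim_compose[OF _ filterlim_subseq[OF r]] top by (auto simp: comp_def)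
  have "P x y = merw_kernel UNIV (adjacency \<gamma>) (psi_delta \<gamma> \<delta>) x y" for x y
  proof (rule LIMSEQ_unique)
    show "(\<lambda>j. Q (r j) x y) \<longlonglongrightarrow> P x y"
      using LIMSEQ_subseq_LIMSEQ[OF lim r] by (simp add: comp_def)
    \<comment> \<open>A MERW on a finite interval is determined only at vertices of that interval,
      so equality starts once both \<open>x\<close> and \<open>y\<close> have been absorbed.\<close>
    have "\<forall>\<^sub>F j in sequentially. merw_kernel (H ((p \<circ> r) j) ((q \<circ> r) j)) (adjacency \<gamma>)
        (psi_pq \<gamma> ((p \<circ> r) j) ((q \<circ> r) j)) x y = Q (r j) x y"
      using eventually_mem_H[OF top', of x] eventually_mem_H[OF top', of y]
      by eventually_elim (use is_merw_H_unique[OF \<gamma> pq Q] in \<open>simp add: comp_def\<close>)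
    then show "(\<lambda>j. Q (r j) x y) \<longlonglongrightarrow> merw_kernel UNIV (adjacency \<gamma>) (psi_delta \<gamma> \<delta>) x y"
      by (rule Lim_transform_eventually[rotated])
         (rule merw_kernel_tendsto[OF \<gamma> _ _ top' \<delta>]; simp add: pq)
  qed
  then show "P \<in> {merw_kernel UNIV (adjacency \<gamma>) (psi_delta \<gamma> \<delta>) | \<delta>. True}" by blast
next
  fix P assume "P \<in> {merw_kernel UNIV (adjacency \<gamma>) (psi_delta \<gamma> \<delta>) | \<delta>. True}"
  then obtain \<delta> where P: "P = merw_kernel UNIV (adjacency \<gamma>) (psi_delta \<gamma> \<delta>)" by blast
  obtain p q where pq: "\<And>j. 2 \<le> p j" "\<And>j. 2 \<le> q j"
    and top: "filterlim p at_top sequentially" "filterlim q at_top sequentially"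
    and \<delta>: "diff_tendsto p q \<delta>"
    using diff_tendsto_exists[of \<delta>] by blast
  have pq1: "1 \<le> p j" "1 \<le> q j" for j
    using pq[of j] by simp_all
  show "P \<in> merw_limits (adjacency \<gamma>)"
    unfolding merw_limits_def P mem_Collect_eq
  proof (intro conjI exI allI)
    show "filterlim p at_top sequentially" "filterlim q at_top sequentially" by fact+
    show "is_merw (H (p j) (q j)) (adjacency \<gamma>)
        (merw_kernel (H (p j) (q j)) (adjacency \<gamma>) (psi_pq \<gamma> (p j) (q j)))" for j
      by (rule is_merw_H[OF \<gamma> pq(1) pq1(2)])
  qed (use pq1 is_merw_psi_delta[OF \<gamma>] merw_kernel_tendsto[OF \<gamma> pq1 top \<delta>] in blast)+
qed

lemma psi_pq_exists_unique_pos: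
  assumes \<gamma>: "0 < \<gamma>" "\<gamma> < 1" and pq: "1 \<le> p" "1 \<le> q"
  shows "(\<exists>!\<psi>. is_psi_pq \<gamma> p q \<psi>) \<and> (\<forall>n\<in>H p q. 0 < psi_pq \<gamma> p q n)"
proof -
  obtain \<theta> where "principal_angle \<gamma> p q \<theta>"
    using principal_angle_exists assms by blast
  then interpret boundary_angle \<gamma> p q \<theta> by unfold_locales (use assms in auto)
  show ?thesis by (simp add: is_psi_pq_iff psi_pq_eq glued_sine_pos)
qed

theorem proposition2p2:
  fixes \<gamma> :: real
  assumes "0 < \<gamma>" and "\<gamma> < 1"
  shows "(\<forall>p q. 1 \<le> p \<and> 1 \<le> q \<longrightarrow>
            (\<exists>!\<psi>. is_psi_pq \<gamma> p q \<psi>) \<and> (\<forall>n\<in>H p q. 0 < psi_pq \<gamma> p q n)) \<and>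
         (\<forall>\<delta>. mu \<gamma> \<delta> \<in> {0..1}) \<and>
         limit_points_pq (psi_pq \<gamma>) = {psi_delta \<gamma> \<delta> | \<delta>. True} \<and>
         merw_limits (adjacency \<gamma>) =
           {merw_kernel UNIV (adjacency \<gamma>) (psi_delta \<gamma> \<delta>) | \<delta>. True}"
  using psi_pq_exists_unique_pos[OF assms] mu_in_unit_interval[OF assms]
    limit_points_psi_pq[OF assms] merw_limits_adjacency[OF assms]
  by blast

end
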